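(* Let $\mathcal{F}=\{F_1,\ldots,F_s\}\subset\mathbb{K}[x,y,z]$, $s\ge 2$, be such that its zero set $\mathcal{C}\subset\mathbb{F}^3$ is an irreducible (over $\mathbb{F}$), real, non-planar affine space curve, and assume: (i) $\mathrm{card}(\mathcal{C}^\infty)=\deg(\mathcal{C})$; (ii) $\pi_z:\mathcal{C}\to\pi_z(\mathcal{C})^*$ is birational and $\deg(\mathcal{C})=\deg(\pi_z(\mathcal{C})^* )$; (iii) $(1:0:\lambda:0),(0:1:\mu:0),(0:0:1:0)\notin\mathcal{C}^\infty$ for all $\lambda,\mu\in\mathbb{F}$; (iv) if $(1:\lambda:\mu:0),(1:\lambda:\mu^*:0)\in\mathcal{C}^\infty$ then $\mu=\mu^*$; (v) the coefficient of $z^{\mathrm{tdeg}(F_1)}$ in $F_1$ is a non-zero constant. Let $\mathcal{D}\subset\mathbb{F}^2$ be the rational plane curve given by a rational parametrization $\mathcal{Q}(t)=\left(\frac{p_1(t)}{q(t)},\frac{p_2(t)}{q(t)}\right)$, $p_1,p_2,q\in\mathbb{K}[t]$, such that $\deg(\mathcal{D})=\deg(\pi_z(\mathcal{C})^* )$, $\mathcal{D}^\infty=\pi_z(\mathcal{C})^\infty$, $\deg(p_i)\le\deg(q)=\deg(\mathcal{D})$ and $\gcd(p_i,q)=1$ for $i=1,2$, and such that every point of $\mathcal{D}^\infty$ is of the form $(p_1(t_0):p_2(t_0):q(t_0))$ for some $t_0\in\mathbb{F}$. Let $\overline{\mathcal{C}}\subset\mathbb{F}^3$ be the lifted curve of $\mathcal{D}$,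 i.e. the curve parametrized by $\mathcal{P}(t)=\left(\frac{p_1(t)}{q(t)},\frac{p_2(t)}{q(t)},\frac{p_3(t)}{q(t)}\right)$ with $p_3$ the interpolating polynomial described in the context. Then: 1. $\overline{\mathcal{C}}$ is rational. 2. $\mathcal{C}^\infty=\overline{\mathcal{C}}^\infty$. 3. $\deg(\mathcal{C})=\deg(\overline{\mathcal{C}})$. 4. $\pi_z(\overline{\mathcal{C}})^*=\mathcal{D}$.
   Context: $\mathbb{K}$ is a computable subfield of $\mathbb{R}$ and $\mathbb{F}\subset\mathbb{C}$ is its algebraic closure. For $\mathcal{A}\subset\mathbb{F}^n$ ($n=2,3$), $\mathcal{A}^*$ denotes its Zariski closure, $\mathcal{A}^h$ the projective closure of $\mathcal{A}^*$ in $\mathbb{P}^n(\mathbb{F})$, and $\mathcal{A}^\infty$ the intersection of $\mathcal{A}^h$ with the hyperplane $w=0$; projective coordinates are $(x:y:z:w)$ in $\mathbb{P}^3(\mathbb{F})$ and $(x:y:w)$ in $\mathbb{P}^2(\mathbb{F})$. $\pi_z:\mathbb{F}^3\to\mathbb{F}^2$ is $(x,y,z)\mapsto(x,y)$. $\mathrm{tdeg}$ is the total degree. A curve is real if it has infinitely many real points; it is planar if it is contained in a plane. The curve given by a rational parametrization is the Zariski closure of its image. Construction of the lifted curve. Let $d=\deg(\mathcal{C})$. The hypotheses imply that $\deg(q)=d$, that $q$ is square-free with roots $\xi_1,\ldots,\xi_d\in\mathbb{F}$, that $p_1(\xi_i)\neq 0$, and that $\mathcal{D}^\infty=\{(1:p_2(\xi_i)/p_1(\xi_i):0)\}_{i=1,\ldots,d}$.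 For each $i$ there is a unique $\chi_i\in\mathbb{F}$ with $(1:p_2(\xi_i)/p_1(\xi_i):\chi_i:0)\in\mathcal{C}^\infty$. Then $p_3(t)$ is the unique polynomial of degree less than $d$ such that $p_3(\xi_i)=p_1(\xi_i)\chi_i$ for $i=1,\ldots,d$, and $\overline{\mathcal{C}}$ is the curve parametrized by $\left(\frac{p_1}{q},\frac{p_2}{q},\frac{p_3}{q}\right)$. *)

theory Defs
  imports "HOL-Analysis.Analysis" "HOL-Library.Poly_Mapping" "HOL-Library.Extended_Nat"
    "HOL-Computational_Algebra.Polynomial"
begin

section \<open>Computable subfields of the reals and their algebraic closures\<close>

definition is_subfield :: "'a::field set \<Rightarrow> bool" where
  "is_subfield K \<longleftrightarrow> 0 \<in> K \<and> 1 \<in> K \<and>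
     (\<forall>a\<in>K. \<forall>b\<in>K. a + b \<in> K \<and> a * b \<in> K) \<and>
     (\<forall>a\<in>K. - a \<in> K \<and> inverse a \<in> K)"

text \<open>
  The total recursive functions of arity \<open>n\<close>, as functions on argument lists; only the values on
  lists of length \<open>n\<close> are meaningful.  Minimization is restricted to regular functions, which by
  Kleene's normal form theorem still yields all total recursive functions.
\<close>

inductive recursive :: "nat \<Rightarrow> (nat list \<Rightarrow> nat) \<Rightarrow> bool" where
  zero: "recursive n (\<lambda>xs. 0)"
| succ: "recursive 1 (\<lambda>xs. Suc (xs ! 0))"
| proj: "i < n \<Longrightarrow> recursive n (\<lambda>xs. xs ! i)"
| comp: "recursive (length gs) f \<Longrightarrow> (\<forall>g\<in>set gs. recursive n g) \<Longrightarrow>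
    recursive n (\<lambda>xs. f (map (\<lambda>g. g xs) gs))"
| prec: "recursive n f \<Longrightarrow> recursive (n + 2) g \<Longrightarrow>
    recursive (n + 1) (\<lambda>xs. rec_nat (f (tl xs)) (\<lambda>k r. g (k # r # tl xs)) (hd xs))"
| mu: "recursive (n + 1) f \<Longrightarrow> (\<forall>xs. length xs = n \<longrightarrow> (\<exists>y. f (y # xs) = 0)) \<Longrightarrow>
    recursive n (\<lambda>xs. LEAST y. f (y # xs) = 0)"

text \<open>
  A computable field in the sense of Froehlich--Shepherdson and Rabin: its elements can be coded
  injectively by a recursive set of natural numbers so that addition and multiplication become
  recursive.  (Negation and inversion are then recursive by search.)
\<close>

definition computable_subfield :: "'a::field set \<Rightarrow> bool" where
  "computable_subfield K \<longleftrightarrow> is_subfield K \<and>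
     (\<exists>code :: 'a \<Rightarrow> nat. inj_on code K \<and>
        (\<exists>c. recursive 1 c \<and> (\<forall>n. c [n] = (if n \<in> code ` K then 1 else 0))) \<and>
        (\<exists>f. recursive 2 f \<and> (\<forall>a\<in>K. \<forall>b\<in>K. f [code a, code b] = code (a + b))) \<and>
        (\<exists>f. recursive 2 f \<and> (\<forall>a\<in>K. \<forall>b\<in>K. f [code a, code b] = code (a * b))))"

definition poly_over :: "complex set \<Rightarrow> complex poly \<Rightarrow> bool" where
  "poly_over K p \<longleftrightarrow> (\<forall>i. coeff p i \<in> K)"

definition alg_closure :: "complex set \<Rightarrow> complex set" where
  "alg_closure K = {z. \<exists>p. p \<noteq> 0 \<and> poly_over K p \<and> poly p z = 0}"

section \<open>Multivariate polynomials\<close>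

text \<open>
  A polynomial in variables indexed by \<open>'n\<close> is a finitely supported map from exponent vectors to
  coefficients.  In dimension 3 the variables x, y, z have the indices 1, 2, 3, and
  correspondingly in dimension 2.
\<close>

type_synonym 'n mpoly = "('n \<Rightarrow>\<^sub>0 nat) \<Rightarrow>\<^sub>0 complex"

definition mpoly_over :: "complex set \<Rightarrow> 'n mpoly \<Rightarrow> bool" where
  "mpoly_over K f \<longleftrightarrow> (\<forall>m. Poly_Mapping.lookup f m \<in> K)"

definition mon_degree :: "('n::finite \<Rightarrow>\<^sub>0 nat) \<Rightarrow> nat" where
  "mon_degree m = (\<Sum>i\<in>UNIV. Poly_Mapping.lookup m i)"

definition tdeg :: "'n::finite mpoly \<Rightarrow> nat" where
  "tdeg f = (if f = 0 then 0 else Max (mon_degree ` Poly_Mapping.keys f))"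

definition homogeneous :: "'n::finite mpoly \<Rightarrow> bool" where
  "homogeneous f \<longleftrightarrow> (\<exists>k. \<forall>m\<in>Poly_Mapping.keys f. mon_degree m = k)"

definition meval :: "'n::finite mpoly \<Rightarrow> complex ^ 'n \<Rightarrow> complex" where
  "meval f v = (\<Sum>m\<in>Poly_Mapping.keys f.
     Poly_Mapping.lookup f m * (\<Prod>i\<in>UNIV. (v $ i) ^ Poly_Mapping.lookup m i))"

section \<open>Affine algebraic sets over F\<close>

definition aff_space :: "complex set \<Rightarrow> (complex ^ 'n) set" where
  "aff_space F = {v. \<forall>i. v $ i \<in> F}"

definition zeros :: "complex set \<Rightarrow> 'n::finite mpoly set \<Rightarrow> (complex ^ 'n) set" where
  "zeros F S = {v \<in> aff_space F. \<forall>f\<in>S. meval f v = 0}"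

definition zclosed :: "complex set \<Rightarrow> (complex ^ 'n::finite) set \<Rightarrow> bool" where
  "zclosed F X \<longleftrightarrow> (\<exists>S. (\<forall>f\<in>S. mpoly_over F f) \<and> X = zeros F S)"

definition zclosure :: "complex set \<Rightarrow> (complex ^ 'n::finite) set \<Rightarrow> (complex ^ 'n) set" where
  "zclosure F A = zeros F {f. mpoly_over F f \<and> (\<forall>a\<in>A. meval f a = 0)}"

definition zirreducible :: "complex set \<Rightarrow> (complex ^ 'n::finite) set \<Rightarrow> bool" where
  "zirreducible F X \<longleftrightarrow> zclosed F X \<and> X \<noteq> {} \<and>
     (\<forall>A B. zclosed F A \<longrightarrow> zclosed F B \<longrightarrow> X = A \<union> B \<longrightarrow> X = A \<or> X = B)"

text \<open>Krull dimension of the Zariski topology on \<open>X\<close>.\<close>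

definition zdim :: "complex set \<Rightarrow> (complex ^ 'n::finite) set \<Rightarrow> enat" where
  "zdim F X = Sup {enat n | n. \<exists>Z :: nat \<Rightarrow> (complex ^ 'n) set.
     (\<forall>i\<le>n. zirreducible F (Z i) \<and> Z i \<subseteq> X) \<and> (\<forall>i<n. Z i \<subset> Z (Suc i))}"

definition irreducible_curve :: "complex set \<Rightarrow> (complex ^ 'n::finite) set \<Rightarrow> bool" where
  "irreducible_curve F X \<longleftrightarrow> zirreducible F X \<and> zdim F X = 1"

definition real_curve :: "(complex ^ 'n) set \<Rightarrow> bool" where
  "real_curve X \<longleftrightarrow> infinite {v \<in> X. \<forall>i. v $ i \<in> \<real>}"

definition is_hyperplane :: "complex set \<Rightarrow> (complex ^ 'n::finite) set \<Rightarrow> bool" where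
  "is_hyperplane F H \<longleftrightarrow> (\<exists>a\<in>aff_space F. \<exists>b\<in>F. a \<noteq> 0 \<and>
     H = {v \<in> aff_space F. (\<Sum>i\<in>UNIV. a $ i * v $ i) = b})"

definition planar :: "complex set \<Rightarrow> (complex ^ 3) set \<Rightarrow> bool" where
  "planar F X \<longleftrightarrow> (\<exists>H. is_hyperplane F H \<and> X \<subseteq> H)"

text \<open>
  The degree of an affine curve: the maximal finite number of intersection points with a
  hyperplane (a line for plane curves, a plane for space curves).  It is attained by the generic
  hyperplane, so it agrees with the degree of the projective closure.
\<close>

definition curve_degree :: "complex set \<Rightarrow> (complex ^ 'n::finite) set \<Rightarrow> nat" where
  "curve_degree F X = Sup {card (X \<inter> H) | H. is_hyperplane F H \<and> finite (X \<inter> H)}"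

section \<open>Projective closure and points at infinity\<close>

text \<open>
  Homogeneous coordinates are indexed by \<open>'n option\<close>: \<open>Some i\<close> for the affine variables and
  \<open>None\<close> for w.  The projective point \<open>proj_pt F v w\<close>, written (v : w), is the class of all
  nonzero F-multiples of its coordinate vector.
\<close>

definition hcoords :: "complex ^ 'n \<Rightarrow> complex \<Rightarrow> complex ^ 'n option" where
  "hcoords v w = (\<chi> j. case j of None \<Rightarrow> w | Some i \<Rightarrow> v $ i)"

definition proj_pt :: "complex set \<Rightarrow> complex ^ 'n \<Rightarrow> complex \<Rightarrow> (complex ^ 'n option) set" where
  "proj_pt F v w = {c *s hcoords v w | c. c \<in> F \<and> c \<noteq> 0}"

definition proj_closure ::
  "complex set \<Rightarrow> (complex ^ 'n::finite) set \<Rightarrow> (complex ^ 'n option) set set" where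
  "proj_closure F A = {proj_pt F v w | v w. v \<in> aff_space F \<and> w \<in> F \<and> (v \<noteq> 0 \<or> w \<noteq> 0) \<and>
     (\<forall>g. mpoly_over F g \<and> homogeneous g \<and> (\<forall>a\<in>zclosure F A. meval g (hcoords a 1) = 0)
        \<longrightarrow> meval g (hcoords v w) = 0)}"

definition pts_at_infinity ::
  "complex set \<Rightarrow> (complex ^ 'n::finite) set \<Rightarrow> (complex ^ 'n option) set set" where
  "pts_at_infinity F A = proj_closure F A \<inter> {proj_pt F v 0 | v. v \<in> aff_space F \<and> v \<noteq> 0}"

section \<open>Birational maps, rational curves, parametrizations\<close>

definition regular_on ::
  "complex set \<Rightarrow> (complex ^ 'm::finite) set \<Rightarrow> (complex ^ 'm \<Rightarrow> complex ^ 'n) \<Rightarrow> bool" where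
  "regular_on F U \<phi> \<longleftrightarrow> (\<exists>num den :: 'n \<Rightarrow> 'm mpoly.
     \<forall>i. mpoly_over F (num i) \<and> mpoly_over F (den i) \<and>
         (\<forall>v\<in>U. meval (den i) v \<noteq> 0 \<and> \<phi> v $ i = meval (num i) v / meval (den i) v))"

definition zopen_in ::
  "complex set \<Rightarrow> (complex ^ 'n::finite) set \<Rightarrow> (complex ^ 'n) set \<Rightarrow> bool" where
  "zopen_in F X U \<longleftrightarrow> (\<exists>Z. zclosed F Z \<and> U = X - Z)"

text \<open>
  For irreducible closed \<open>X\<close> and \<open>Y\<close>: \<open>\<phi>\<close> restricts to an isomorphism between nonempty open
  subsets of \<open>X\<close> and \<open>Y\<close>.  The values of \<open>\<phi>\<close> and \<open>\<psi>\<close> elsewhere are irrelevant.  The open sets may be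
  shrunk, so coordinates given by one fraction on the whole open set are no restriction.
\<close>

definition birational_map ::
  "complex set \<Rightarrow> (complex ^ 'm::finite) set \<Rightarrow> (complex ^ 'n::finite) set \<Rightarrow>
     (complex ^ 'm \<Rightarrow> complex ^ 'n) \<Rightarrow> bool" where
  "birational_map F X Y \<phi> \<longleftrightarrow>
     (\<exists>U V \<psi>. zopen_in F X U \<and> U \<noteq> {} \<and> zopen_in F Y V \<and> V \<noteq> {} \<and>
        regular_on F U \<phi> \<and> regular_on F V \<psi> \<and>
        \<phi> ` U = V \<and> (\<forall>u\<in>U. \<psi> (\<phi> u) = u))"

text \<open>
  By Lueroth's theorem this is equivalent to possessing a (not necessarily injective) rational
  parametrization with dense image.
\<close>

definition rational_curve :: "complex set \<Rightarrow> (complex ^ 'n::finite) set \<Rightarrow> bool" where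
  "rational_curve F X \<longleftrightarrow> zirreducible F X \<and>
     (\<exists>\<phi>. birational_map F (aff_space F :: (complex ^ 1) set) X \<phi>)"

definition param_curve ::
  "complex set \<Rightarrow> complex poly ^ 'n::finite \<Rightarrow> complex poly \<Rightarrow> (complex ^ 'n) set" where
  "param_curve F p q =
     zclosure F {(\<chi> i. poly (p $ i) t / poly q t) | t. t \<in> F \<and> poly q t \<noteq> 0}"

definition pi_z :: "complex ^ 3 \<Rightarrow> complex ^ 2" where
  "pi_z v = vector [v $ 1, v $ 2]"

section \<open>The lifted curve\<close>

definition lift_value ::
  "complex set \<Rightarrow> (complex ^ 3) set \<Rightarrow> complex poly \<Rightarrow> complex poly \<Rightarrow> complex \<Rightarrow> complex" where
  "lift_value F C p1 p2 \<xi> = (THE c. c \<in> F \<and>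
     proj_pt F (vector [1, poly p2 \<xi> / poly p1 \<xi>, c]) 0 \<in> pts_at_infinity F C)"

definition lift_poly ::
  "complex set \<Rightarrow> (complex ^ 3) set \<Rightarrow> complex poly \<Rightarrow> complex poly \<Rightarrow> complex poly \<Rightarrow> complex poly" where
  "lift_poly F C p1 p2 q = (THE p3. poly_over F p3 \<and> degree p3 < curve_degree F C \<and>
     (\<forall>\<xi>\<in>F. poly q \<xi> = 0 \<longrightarrow> poly p3 \<xi> = poly p1 \<xi> * lift_value F C p1 p2 \<xi>))"

definition lifted_curve ::
  "complex set \<Rightarrow> (complex ^ 3) set \<Rightarrow> complex poly \<Rightarrow> complex poly \<Rightarrow> complex poly \<Rightarrow> (complex ^ 3) set"
  where
  "lifted_curve F C p1 p2 q = param_curve F (vector [p1, p2, lift_poly F C p1 p2 q]) q"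

end

theory Submission
  imports Jordan_Normal_Form.Determinant "HOL-Algebra.Finite_Extensions" Defs
    "HOL-Computational_Algebra.Fundamental_Theorem_Algebra"
begin

text \<open>
  Write \<open>d\<close> for the degree of \<open>q\<close>.  Everything rests on a count.  By (iii) and (iv) the points of
  \<open>C\<close> at infinity are of the form \<open>(1 : l : m : 0)\<close>, with \<open>m\<close> determined by \<open>l\<close>.  Then \<open>(1 : l : 0)\<close> is
  a point at infinity of the projection of \<open>C\<close>, hence of \<open>D\<close>, so \<open>l = p2(\<xi>) / p1(\<xi>)\<close> for a root \<open>\<xi>\<close>
  of \<open>q\<close>.  As \<open>C\<close> has \<open>d\<close> points at infinity, there are \<open>d\<close> such values \<open>l\<close>, whereas \<open>q\<close> has at most \<open>d\<close>
  roots.  So \<open>q\<close> has \<open>d\<close> simple roots, the values \<open>p2(\<xi>) / p1(\<xi>)\<close> are pairwise different, and the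
  roots correspond bijectively to the points of \<open>C\<close> at infinity.  In particular the lifted values and
  the interpolating polynomial \<open>p3\<close> of degree less than \<open>d\<close> exist and are unique.

  What remains concerns the map \<open>P = (p1 : p2 : p3 : q)\<close> from the projective line, given by
  polynomials of degree at most \<open>d\<close> without a common zero.  It is studied with one device.  For a point
  \<open>V\<close> with \<open>V_c \<noteq> 0\<close> consider the polynomials \<open>A_j = V_c P_j - V_j P_c\<close>, whose common zeros are the
  parameters of \<open>V\<close>.

  If \<open>V\<close> is not in the image, the \<open>A_j\<close> have no common zero, and Bezout's identity with control of the
  degrees writes each \<open>P_c t^i\<close> with \<open>i \<le> d\<close> as a combination of the \<open>A_j\<close> with coefficients of degree
  at most \<open>d\<close>.  So \<open>(1, t, \<dots>, t^d)\<close> is in the kernel of a matrix of linear forms in \<open>P(t)\<close>.  Its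
  determinant is a form that vanishes on the image, but not at \<open>V\<close>, where the matrix is \<open>V_c\<close> times the
  identity.  Thus the image is closed (\<open>image_of_proper_param_closed\<close>): the projective closure of the
  lifted curve consists of the points \<open>P(t)\<close>, including the parameter \<open>t = \<infinity>\<close>, which gives an affine
  point.  So the points at infinity are the \<open>P(\<xi>)\<close> for the roots \<open>\<xi>\<close> of \<open>q\<close>.  By the choice of \<open>p3\<close> they are
  the points of \<open>C\<close> at infinity.

  If \<open>V = P(\<xi>)\<close> for a root \<open>\<xi>\<close> of \<open>q\<close>, then by the count \<open>\<xi>\<close> is the only common zero of the \<open>A_j\<close>, and it
  is simple.  Now the polynomials \<open>P_c t^i (t - \<xi>)\<close> are combinations of the \<open>A_j\<close>, which gives an
  inhomogeneous linear system for \<open>t, \<dots>, t^d\<close> whose matrix is invertible at \<open>\<xi>\<close>.  Cramer's rule expresses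
  \<open>t\<close> as a quotient of two forms in \<open>P(t)\<close> (\<open>inverse_of_param_unramified_at\<close>), so the parametrization
  is birational.  Hence the lifted curve is rational, and its degree is \<open>d\<close>: a hyperplane section
  corresponds to the roots of a polynomial of degree at most \<open>d\<close>, and a general plane \<open>x = b\<close> meets the
  curve in \<open>d\<close> points.  Finally, forgetting the third coordinate maps the points \<open>P(t)\<close> to the points
  of the parametrization of \<open>D\<close>, which gives the last claim.
\<close>

text \<open>
  In what follows \<open>degree\<close>, \<open>coeff\<close>, \<open>order\<close> and the like refer to univariate polynomials, and
  \<open>v $ i\<close> to vectors indexed by a finite type.
\<close>
hide_const (open) Matrix.vec_index Determinant.det Polynomials.degree Polynomials.lead_coeff
  Module.smult Matrix.vec Coset.order up_ring.monom up_ring.coeff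
no_notation Matrix.vec_index (infixl \<open>$\<close> 100)

section \<open>The algebraic closure of a subfield of the complex numbers\<close>

text \<open>
  The field structure in the sense of locales with explicit carriers, in which subfields and their
  algebraic extensions are sets of complex numbers.
\<close>
definition complex_ring :: "complex ring" where
  "complex_ring = \<lparr>carrier = UNIV, monoid.mult = (*), one = 1, ring.zero = 0, add = (+)\<rparr>"

lemma complex_ring_simps [simp]:
  "carrier complex_ring = UNIV" "x \<otimes>\<^bsub>complex_ring\<^esub> y = x * y" "\<one>\<^bsub>complex_ring\<^esub> = 1"
  "\<zero>\<^bsub>complex_ring\<^esub> = 0" "x \<oplus>\<^bsub>complex_ring\<^esub> y = x + y"
  by (simp_all add: complex_ring_def)

lemma field_complex_ring: "Ring.field complex_ring"
proof -
  have "\<exists>y. x + y = 0" for x :: complex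
    by (rule exI[of _ "- x"]) auto
  moreover have "x \<noteq> 0 \<Longrightarrow> \<exists>y. x * y = 1" for x :: complex
    by (rule exI[of _ "inverse x"]) auto
  ultimately show ?thesis
    using add.right_inverse
    by unfold_locales (auto simp: algebra_simps Units_def)
qed

lemma domain_complex_ring: "domain complex_ring"
  using field_complex_ring by (rule field.axioms)

interpretation cx: ring complex_ring
  using domain_complex_ring by (simp add: domain_def cring_def)

lemma cx_pow [simp]: "x [^]\<^bsub>complex_ring\<^esub> (n::nat) = x ^ n"
  by (induction n) (auto simp: nat_pow_def)

lemma cx_uminus [simp]: "\<ominus>\<^bsub>complex_ring\<^esub> x = - x"
  by (metis UNIV_I add.right_inverse complex_ring_simps(1,4,5) cx.minus_equality add.commute)

lemma cx_inv: "x \<noteq> 0 \<Longrightarrow> inv\<^bsub>complex_ring\<^esub> x = inverse x"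
  by (rule comm_monoid.comm_inv_char[OF cring.axioms(2)[OF domain.axioms(1)[OF domain_complex_ring]]]) auto

lemma subfield_complex_ring_iff: "subfield K complex_ring \<longleftrightarrow> is_subfield K"
proof
  assume K: "subfield K complex_ring"
  note R = subfieldE(1)[OF K]
  have "inverse a \<in> K" if "a \<in> K" for a
  proof (cases "a = 0")
    case False
    then show ?thesis using cx.subfield_m_inv(1)[OF K, of a] that cx_inv by auto
  qed (use that in simp)
  then show "is_subfield K"
    unfolding is_subfield_def using subringE[OF R] by auto
next
  assume K: "is_subfield K"
  show "subfield K complex_ring"
    by (rule field.subfieldI'[OF field_complex_ring cx.subringI]) (use K in \<open>auto simp: is_subfield_def cx_inv\<close>)
qed

text \<open>
  Polynomials over a structure are lists of coefficients with the leading one first.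
\<close>
lemma cx_eval: "cx.eval p x = poly (Poly (rev p)) x"
  by (induction p) (auto simp: Poly_snoc poly_monom)

lemma alg_closure_iff: "x \<in> alg_closure K \<longleftrightarrow> (cx.algebraic over K) x" if "is_subfield K"
proof
  assume "x \<in> alg_closure K"
  then obtain p where p: "p \<noteq> 0" "poly_over K p" "poly p x = 0"
    by (auto simp: alg_closure_def)
  have "set (coeffs p) \<subseteq> K"
    using p by (auto simp: poly_over_def coeffs_def)
  moreover have "hd (rev (coeffs p)) \<noteq> 0"
    using p by (simp add: hd_rev last_coeffs_eq_coeff_degree)
  ultimately have "polynomial\<^bsub>complex_ring\<^esub> K (rev (coeffs p))"
    by (auto simp: polynomial_def)
  then show "(cx.algebraic over K) x"
    using p by (intro cx.algebraicI[of "rev (coeffs p)"]) (auto simp: univ_poly_carrier cx_eval)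
next
  assume "(cx.algebraic over K) x"
  moreover have "subring K complex_ring"
    using that subfield_complex_ring_iff subfieldE(1) by blast
  ultimately obtain p where p: "p \<in> carrier (K[X]\<^bsub>complex_ring\<^esub>)" "p \<noteq> []" "cx.eval p x = 0"
    using domain.algebraicE[OF domain_complex_ring, of K x] by auto
  then have sp: "set p \<subseteq> K" "hd p \<noteq> 0"
    by (auto simp: univ_poly_carrier[symmetric] polynomial_def)
  have "coeff (Poly (rev p)) i \<in> K" for i
    using sp that by (auto simp: nth_default_def is_subfield_def subset_iff)
      (metis diff_less_Suc in_set_conv_nth length_rev set_rev)
  moreover have "coeff (Poly (rev p)) (length p - 1) \<noteq> 0"
    using sp p(2) by (auto simp: nth_default_def hd_conv_nth rev_nth)
  then have "Poly (rev p) \<noteq> 0"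
    by (metis coeff_0)
  ultimately show "x \<in> alg_closure K"
    using p by (auto simp: alg_closure_def poly_over_def cx_eval)
qed

lemma is_subfield_alg_closure:
  assumes "is_subfield K"
  shows "is_subfield (alg_closure K)"
proof -
  have "alg_closure K = {x \<in> carrier complex_ring. (cx.algebraic over K) x}"
    using alg_closure_iff[OF assms] by auto
  then show ?thesis
    using field.subfield_of_algebraics[OF field_complex_ring, of K] assms by (simp add: subfield_complex_ring_iff)
qed

text \<open>
  An element that is algebraic over the closure is a root of a polynomial whose finitely many
  coefficients generate a finite extension of \<open>K\<close>; so it lies in a finite extension of \<open>K\<close> itself.
\<close>
lemma alg_closure_idem:
  assumes K: "is_subfield K"
  shows "alg_closure (alg_closure K) \<subseteq> alg_closure K"
proof
  fix x assume "x \<in> alg_closure (alg_closure K)"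
  then obtain p where p: "p \<noteq> 0" "poly_over (alg_closure K) p" "poly p x = 0"
    by (auto simp: alg_closure_def)
  define L where "L = cx.finite_extension K (coeffs p)"
  have K': "subfield K complex_ring"
    using K by (simp add: subfield_complex_ring_iff)
  have alg: "(cx.algebraic over K) c" if "c \<in> set (coeffs p)" for c
    using that p(2) alg_closure_iff[OF K, of c]
    by (auto simp: coeffs_def poly_over_def split: if_splits)
  have L: "subfield L complex_ring" "cx.finite_dimension K L"
    unfolding L_def using alg
    by (auto intro!: domain.finite_extension_is_subfield[OF domain_complex_ring K']
        domain.finite_extension_finite_dimension(1)[OF domain_complex_ring K'] simp del: cx.finite_extension.simps)
  have "set (coeffs p) \<subseteq> L"
    unfolding L_def by (rule domain.finite_extension_mem[OF domain_complex_ring subfieldE(1)[OF K']]) auto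
  moreover have "0 \<in> L"
    using L(1) by (auto simp: subfield_complex_ring_iff is_subfield_def)
  ultimately have "poly_over L p"
    unfolding poly_over_def using range_coeff[of p] by (metis insertE rangeI subsetD)
  then have "x \<in> alg_closure L"
    using p by (auto simp: alg_closure_def)
  then have "(cx.algebraic over L) x"
    using alg_closure_iff L(1) by (simp add: subfield_complex_ring_iff)
  then have "cx.finite_dimension L (cx.simple_extension L x)"
    using domain.finite_dimension_simple_extension[OF domain_complex_ring L(1), of x] by simp
  then have "cx.finite_dimension K (cx.simple_extension L x)"
    using cx.telescopic_base_dim(1)[OF K' L] by blast
  moreover have "subring (cx.simple_extension L x) complex_ring"
    using domain.simple_extension_is_subring[OF domain_complex_ring subfieldE(1)[OF L(1)]] by simp
  moreover have "x \<in> cx.simple_extension L x"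
    using cx.simple_extension_mem[OF subfieldE(1)[OF L(1)]] by simp
  ultimately have "(cx.algebraic over K) x"
    using cx.finite_dimension_imp_algebraic[OF K'] by blast
  then show "x \<in> alg_closure K"
    using alg_closure_iff[OF K] by blast
qed

lemma subset_alg_closure:
  assumes "is_subfield K"
  shows "K \<subseteq> alg_closure K"
proof
  fix a assume "a \<in> K"
  then have "poly_over K [:- a, 1:]"
    using assms by (auto simp: poly_over_def is_subfield_def coeff_pCons split: nat.splits)
  then show "a \<in> alg_closure K"
    unfolding alg_closure_def by (intro CollectI exI[of _ "[:- a, 1:]"]) auto
qed

section \<open>Polynomials over a relatively algebraically closed subfield\<close>

text \<open>
  As the complex numbers are algebraically closed, a subfield that contains every complex root of each
  of its nonzero polynomials is algebraically closed as well.  In this form roots can be taken in the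
  complex numbers, and they are in \<open>F\<close> automatically.
\<close>
locale rel_alg_closed =
  fixes F :: "complex set"
  assumes subfield: "is_subfield F"
    and root_mem: "\<lbrakk>p \<noteq> 0; poly_over F p; poly p x = 0\<rbrakk> \<Longrightarrow> x \<in> F"
begin

lemma F_0 [simp]: "0 \<in> F" and F_1 [simp]: "1 \<in> F"
  and F_add [simp]: "a \<in> F \<Longrightarrow> b \<in> F \<Longrightarrow> a + b \<in> F"
  and F_mult [simp]: "a \<in> F \<Longrightarrow> b \<in> F \<Longrightarrow> a * b \<in> F"
  and F_uminus [simp]: "a \<in> F \<Longrightarrow> - a \<in> F"
  and F_inverse [simp]: "a \<in> F \<Longrightarrow> inverse a \<in> F"
  using subfield by (auto simp: is_subfield_def)

lemma F_diff [simp]: "a \<in> F \<Longrightarrow> b \<in> F \<Longrightarrow> a - b \<in> F"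
  using F_add[of a "- b"] by simp

lemma F_divide [simp]: "a \<in> F \<Longrightarrow> b \<in> F \<Longrightarrow> a / b \<in> F"
  by (simp add: divide_inverse)

lemma F_sum [intro]: "(\<And>i. i \<in> I \<Longrightarrow> f i \<in> F) \<Longrightarrow> sum f I \<in> F"
  by (induction I rule: infinite_finite_induct) auto

lemma F_power [simp]: "a \<in> F \<Longrightarrow> a ^ n \<in> F"
  by (induction n) auto

lemma F_of_nat [simp]: "of_nat n \<in> F"
  by (induction n) auto

lemma infinite_F: "infinite F"
proof
  assume "finite F"
  then have "finite (range (of_nat :: nat \<Rightarrow> complex))"
    by (rule finite_subset[rotated]) auto
  then show False
    using range_inj_infinite[of "of_nat :: nat \<Rightarrow> complex"] by (simp add: inj_of_nat)
qed

lemma poly_over_0 [simp]: "poly_over F 0" and poly_over_1 [simp]: "poly_over F 1"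
  by (auto simp: poly_over_def coeff_pCons one_pCons split: nat.splits)

lemma poly_over_pCons [simp]: "poly_over F (pCons a p) \<longleftrightarrow> a \<in> F \<and> poly_over F p"
  unfolding poly_over_def by (metis (no_types) coeff_pCons_0 coeff_pCons_Suc not0_implies_Suc)

lemma poly_over_add [simp]: "poly_over F p \<Longrightarrow> poly_over F r \<Longrightarrow> poly_over F (p + r)"
  and poly_over_diff [simp]: "poly_over F p \<Longrightarrow> poly_over F r \<Longrightarrow> poly_over F (p - r)"
  and poly_over_smult [simp]: "a \<in> F \<Longrightarrow> poly_over F p \<Longrightarrow> poly_over F (smult a p)"
  and poly_over_monom [simp]: "a \<in> F \<Longrightarrow> poly_over F (monom a n)"
  by (auto simp: poly_over_def)

lemma poly_over_mult [simp]: "poly_over F p \<Longrightarrow> poly_over F r \<Longrightarrow> poly_over F (p * r)"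
  by (auto simp: poly_over_def coeff_mult intro!: F_sum)

lemma poly_over_sum [intro]: "(\<And>i. i \<in> I \<Longrightarrow> poly_over F (f i)) \<Longrightarrow> poly_over F (sum f I)"
  by (induction I rule: infinite_finite_induct) auto

lemma poly_over_prod [intro]: "(\<And>i. i \<in> I \<Longrightarrow> poly_over F (f i)) \<Longrightarrow> poly_over F (prod f I)"
  by (induction I rule: infinite_finite_induct) auto

lemma poly_over_coeff [simp]: "poly_over F p \<Longrightarrow> coeff p i \<in> F"
  by (auto simp: poly_over_def)

lemma poly_in_F [simp]: "poly_over F p \<Longrightarrow> t \<in> F \<Longrightarrow> poly p t \<in> F"
  unfolding poly_altdef by (intro F_sum) auto

text \<open>
  Long division only divides by the leading coefficient of \<open>g\<close>, so it stays within \<open>F\<close>.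
\<close>
lemma division_over:
  assumes "poly_over F f" "poly_over F g" "g \<noteq> 0"
  obtains u r where "poly_over F u" "poly_over F r" "f = g * u + r" "r = 0 \<or> degree r < degree g"
proof -
  have "\<exists>u r. poly_over F u \<and> poly_over F r \<and> f = g * u + r \<and> (r = 0 \<or> degree r < degree g)"
    using assms(1)
  proof (induction "degree f" arbitrary: f rule: less_induct)
    case less
    show ?case
    proof (cases "f = 0 \<or> degree f < degree g")
      case True
      then show ?thesis using less.prems by (intro exI[of _ 0] exI[of _ f]) auto
    next
      case False
      define m where "m = monom (lead_coeff f / lead_coeff g) (degree f - degree g)"
      have m: "poly_over F m" unfolding m_def using less.prems assms by auto
      have lc: "coeff (g * m) (degree f) = lead_coeff f"
        using False assms(3) by (simp add: m_def mult.commute[of g] coeff_monom_mult)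
      have dm: "degree (g * m) \<le> degree f"
        using False assms(3) by (auto simp: m_def degree_mult_eq degree_monom_eq)
      show ?thesis
      proof (cases "f - g * m = 0")
        case True
        then show ?thesis using m by (intro exI[of _ m] exI[of _ 0]) auto
      next
        case ne: False
        have "degree (f - g * m) < degree f"
        proof -
          have "degree (f - g * m) \<le> degree f"
            using dm by (intro degree_diff_le) auto
          moreover have "degree (f - g * m) \<noteq> degree f"
          proof
            assume "degree (f - g * m) = degree f"
            then have "lead_coeff (f - g * m) = 0"
              using lc by simp
            then show False using ne by (simp only: leading_coeff_0_iff)
          qed
          ultimately show ?thesis by simp
        qed
        then obtain u r where "poly_over F u" "poly_over F r" "f - g * m = g * u + r"
          "r = 0 \<or> degree r < degree g"
          using less.hyps[of "f - g * m"] less.prems m assms by auto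
        then show ?thesis using m
          by (intro exI[of _ "u + m"] exI[of _ r]) (auto simp: algebra_simps)
      qed
    qed
  qed
  then show ?thesis using that by blast
qed

text \<open>
  The combinations of the \<open>A k\<close> form an ideal, generated by any of its nonzero elements of least
  degree.  This generator is a common divisor of the \<open>A k\<close>, and thus divides \<open>f\<close>.  The point is that
  the coefficients can be chosen over \<open>F\<close>.
\<close>
lemma bezout_over:
  assumes J: "finite J" and A: "\<forall>k\<in>J. poly_over F (A k)" and f: "poly_over F f"
    and dv: "\<forall>g. (\<forall>k\<in>J. g dvd A k) \<longrightarrow> g dvd f"
  obtains B where "\<forall>k\<in>J. poly_over F (B k)" "f = (\<Sum>k\<in>J. A k * B k)"
proof -
  define I where "I = {p. \<exists>B. (\<forall>k\<in>J. poly_over F (B k)) \<and> p = (\<Sum>k\<in>J. A k * B k)}"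
  have I_E: "\<exists>B. (\<forall>k\<in>J. poly_over F (B k)) \<and> p = (\<Sum>k\<in>J. A k * B k)" if "p \<in> I" for p
    using that by (simp only: I_def mem_Collect_eq)
  have I_over: "poly_over F p" if "p \<in> I" for p
    using that A by (auto simp: I_def)
  have I_diff: "p - r \<in> I" if pI: "p \<in> I" and rI: "r \<in> I" for p r
  proof -
    obtain B where B: "\<forall>k\<in>J. poly_over F (B k)" "p = (\<Sum>k\<in>J. A k * B k)"
      using I_E[OF pI] by atomize_elim
    obtain B' where B': "\<forall>k\<in>J. poly_over F (B' k)" "r = (\<Sum>k\<in>J. A k * B' k)"
      using I_E[OF rI] by atomize_elim
    show ?thesis unfolding I_def using B B'
      by (intro CollectI exI[of _ "\<lambda>k. B k - B' k"]) (auto simp: sum_subtractf algebra_simps)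
  qed
  have I_mult: "p * u \<in> I" if pI: "p \<in> I" and "poly_over F u" for p u
  proof -
    obtain B where "\<forall>k\<in>J. poly_over F (B k)" "p = (\<Sum>k\<in>J. A k * B k)"
      using I_E[OF pI] by atomize_elim
    then show ?thesis unfolding I_def using that(2)
      by (intro CollectI exI[of _ "\<lambda>k. B k * u"]) (auto simp: sum_distrib_left algebra_simps)
  qed
  have A_I: "A k \<in> I" if "k \<in> J" for k
    unfolding I_def using that J
    by (intro CollectI exI[of _ "\<lambda>i. if i = k then 1 else 0"]) (auto simp: if_distrib cong: if_cong)
  have zero_I: "0 \<in> I"
    unfolding I_def by (intro CollectI exI[of _ "\<lambda>_. 0"]) auto
  have "f \<in> I"
  proof (cases "I = {0}")
    case True
    then have "0 dvd f" using A_I dv by auto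
    then show ?thesis using zero_I by simp
  next
    case False
    then obtain g0 where g0: "g0 \<in> I \<and> g0 \<noteq> 0" using zero_I by auto
    obtain g where g: "g \<in> I" "g \<noteq> 0"
      and min: "\<And>r. r \<in> I \<Longrightarrow> r \<noteq> 0 \<Longrightarrow> degree g \<le> degree r"
      using ex_has_least_nat[of "\<lambda>g. g \<in> I \<and> g \<noteq> 0" g0 degree, OF g0] by auto
    have "g dvd A k" if k: "k \<in> J" for k
    proof -
      obtain u r where ur: "poly_over F u" "poly_over F r" "A k = g * u + r" "r = 0 \<or> degree r < degree g"
        using division_over[OF A[rule_format, OF k] I_over[OF g(1)] g(2)] by metis
      have "r = A k - g * u" using ur by simp
      then have "r \<in> I" using I_diff I_mult g(1) A_I[OF k] ur(1) by auto
      then have "r = 0" using min[of r] ur(4) by fastforce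
      then show ?thesis using ur by simp
    qed
    then have gf: "g dvd f" using dv by blast
    obtain u r where ur: "poly_over F u" "poly_over F r" "f = g * u + r" "r = 0 \<or> degree r < degree g"
      using division_over[OF f I_over[OF g(1)] g(2)] by metis
    have "g dvd r" using gf ur(3) by (simp add: dvd_add_right_iff)
    then have "r = 0" using ur(4) g(2) dvd_imp_degree_le[of g r] by fastforce
    then show ?thesis using I_mult[OF g(1) ur(1)] ur(3) by simp
  qed
  then obtain B where "\<forall>k\<in>J. poly_over F (B k)" "f = (\<Sum>k\<in>J. A k * B k)"
    using I_E by metis
  then show ?thesis using that by blast
qed

text \<open>
  Reducing every other coefficient modulo \<open>A c\<close>, a polynomial of the greatest possible degree \<open>d\<close>,
  leaves the coefficient of \<open>A c\<close>, whose degree is then bounded by comparing both sides.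
\<close>
lemma bezout_degree_bound:
  assumes J: "finite J" and A: "\<forall>k\<in>J. poly_over F (A k)" and f: "poly_over F f"
    and dv: "\<forall>g. (\<forall>k\<in>J. g dvd A k) \<longrightarrow> g dvd f"
    and dA: "\<forall>k\<in>J. degree (A k) \<le> d" and c: "c \<in> J" "A c \<noteq> 0" "degree (A c) = d"
    and N: "d \<le> Suc N" and df: "degree f \<le> N + d"
  obtains R where "\<forall>k\<in>J. poly_over F (R k) \<and> degree (R k) \<le> N" "f = (\<Sum>k\<in>J. A k * R k)"
proof -
  obtain B where B: "\<forall>k\<in>J. poly_over F (B k)" "f = (\<Sum>k\<in>J. A k * B k)"
    by (rule bezout_over[OF J A f dv])
  have "\<exists>u r. poly_over F u \<and> poly_over F r \<and> B k = A c * u + r \<and> (r = 0 \<or> degree r < degree (A c))"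
    if "k \<in> J" for k
    using division_over[of "B k" "A c"] B(1) A c that by metis
  then obtain u r where ur: "\<And>k. k \<in> J \<Longrightarrow> poly_over F (u k)" "\<And>k. k \<in> J \<Longrightarrow> poly_over F (r k)"
    "\<And>k. k \<in> J \<Longrightarrow> B k = A c * u k + r k" "\<And>k. k \<in> J \<Longrightarrow> r k = 0 \<or> degree (r k) < d"
    unfolding c(3) by metis
  define Y where "Y = B c + (\<Sum>k\<in>J - {c}. A k * u k)"
  have Y: "poly_over F Y" unfolding Y_def using B(1) c(1) A ur(1) by (intro poly_over_add poly_over_sum poly_over_mult) auto
  define S where "S = (\<Sum>k\<in>J - {c}. A k * r k)"
  have "f = A c * B c + (\<Sum>k\<in>J - {c}. A k * B k)"
    unfolding B(2) using J c(1) by (simp add: sum.remove)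
  also have "(\<Sum>k\<in>J - {c}. A k * B k) = (\<Sum>k\<in>J - {c}. A c * (A k * u k) + A k * r k)"
    using ur(3) by (intro sum.cong) (auto simp: algebra_simps)
  also have "\<dots> = A c * (\<Sum>k\<in>J - {c}. A k * u k) + S"
    by (simp add: sum.distrib sum_distrib_left S_def)
  finally have fY: "f = A c * Y + S"
    by (simp add: Y_def algebra_simps)
  have rN: "degree (r k) \<le> N" if "k \<in> J" for k
    using ur(4)[OF that] N by auto
  have dAr: "degree (A k * r k) \<le> N + d" if "k \<in> J - {c}" for k
    using degree_mult_le[of "A k" "r k"] dA[rule_format, of k] rN[of k] that by simp
  have "degree S \<le> N + d"
    unfolding S_def using J dAr by (intro degree_sum_le) auto
  then have "degree (A c * Y) \<le> N + d"
    using fY df degree_diff_le[of f "N + d" S] by simp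
  then have dY: "degree Y \<le> N"
    using c by (cases "Y = 0") (auto simp: degree_mult_eq)
  define R where "R = r(c := Y)"
  have "f = (\<Sum>k\<in>J. A k * R k)"
    unfolding fY S_def R_def using J c(1) by (simp add: sum.remove)
  moreover have "\<forall>k\<in>J. poly_over F (R k) \<and> degree (R k) \<le> N"
    using Y dY ur(2) rN by (auto simp: R_def)
  ultimately show ?thesis using that by blast
qed

end

lemma rel_alg_closed_alg_closure:
  assumes "is_subfield K"
  shows "rel_alg_closed (alg_closure K)"
proof
  show "is_subfield (alg_closure K)" by (rule is_subfield_alg_closure[OF assms])
  show "x \<in> alg_closure K" if "p \<noteq> 0" "poly_over (alg_closure K) p" "poly p x = 0" for p x
    using that alg_closure_idem[OF assms] by (auto simp: alg_closure_def[of "alg_closure K"])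
qed

section \<open>Polynomial functions\<close>

abbreviation monom_val :: "('n::finite \<Rightarrow>\<^sub>0 nat) \<Rightarrow> complex ^ 'n \<Rightarrow> complex" where
  "monom_val m v \<equiv> (\<Prod>i\<in>UNIV. (v $ i) ^ Poly_Mapping.lookup m i)"

lemma meval_superset:
  assumes "finite S" "Poly_Mapping.keys f \<subseteq> S"
  shows "meval f v = (\<Sum>m\<in>S. Poly_Mapping.lookup f m * monom_val m v)"
  unfolding meval_def using assms
  by (intro sum.mono_neutral_left) (auto simp: in_keys_iff)

lemma meval_add: "meval (f + g) v = meval f v + meval g v"
proof -
  let ?S = "Poly_Mapping.keys f \<union> Poly_Mapping.keys g"
  have "meval (f + g) v = (\<Sum>m\<in>?S. Poly_Mapping.lookup (f + g) m * monom_val m v)"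
    by (rule meval_superset) (auto dest: Set.subsetD[OF Poly_Mapping.keys_add])
  moreover have "meval f v = (\<Sum>m\<in>?S. Poly_Mapping.lookup f m * monom_val m v)"
    by (rule meval_superset) auto
  moreover have "meval g v = (\<Sum>m\<in>?S. Poly_Mapping.lookup g m * monom_val m v)"
    by (rule meval_superset) auto
  ultimately show ?thesis
    by (simp add: lookup_add algebra_simps sum.distrib)
qed

lemma meval_single: "meval (Poly_Mapping.single m c) v = c * monom_val m v"
  by (subst meval_superset[of "{m}"]) auto

lemma monom_val_add: "monom_val (m + n) v = monom_val m v * monom_val n v"
  by (simp add: lookup_add power_add prod.distrib)

lemma mon_degree_add: "mon_degree (m + n) = mon_degree m + mon_degree n"
  by (simp add: mon_degree_def lookup_add sum.distrib)

context rel_alg_closed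
begin

text \<open>
  Vanishing of a polynomial only depends on the function it defines, and functions are easier to
  combine than polynomials.  The set \<open>A\<close> restricts the degrees of the monomials, so that \<open>pfun {k}\<close>
  stands for forms of degree \<open>k\<close> and \<open>pfun UNIV\<close> for arbitrary polynomials.
\<close>
definition pfun :: "nat set \<Rightarrow> (complex ^ 'n::finite \<Rightarrow> complex) \<Rightarrow> bool" where
  "pfun A \<phi> \<longleftrightarrow> (\<exists>f. mpoly_over F f \<and> (\<forall>m\<in>Poly_Mapping.keys f. mon_degree m \<in> A) \<and>
     (\<forall>v. \<phi> v = meval f v))"

lemma pfun_mono: "pfun A \<phi> \<Longrightarrow> A \<subseteq> B \<Longrightarrow> pfun B \<phi>"
  unfolding pfun_def by blast

lemma pfun_meval: "mpoly_over F f \<Longrightarrow> pfun UNIV (meval f)"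
  unfolding pfun_def by blast

lemma pfun_zero [simp, intro]: "pfun A (\<lambda>v. 0)"
  unfolding pfun_def by (rule exI[of _ 0]) (auto simp: mpoly_over_def meval_def)

lemma pfun_add [intro]:
  assumes "pfun A \<phi>" "pfun A \<psi>"
  shows "pfun A (\<lambda>v. \<phi> v + \<psi> v)"
proof -
  obtain f where f: "mpoly_over F f" "\<forall>m\<in>Poly_Mapping.keys f. mon_degree m \<in> A" "\<forall>v. \<phi> v = meval f v"
    using assms(1) unfolding pfun_def by blast
  obtain g where g: "mpoly_over F g" "\<forall>m\<in>Poly_Mapping.keys g. mon_degree m \<in> A" "\<forall>v. \<psi> v = meval g v"
    using assms(2) unfolding pfun_def by blast
  show ?thesis unfolding pfun_def
    by (rule exI[of _ "f + g"])
      (use f g Poly_Mapping.keys_add[of f g] in \<open>auto simp: mpoly_over_def lookup_add meval_add\<close>)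
qed

lemma pfun_single:
  assumes "c \<in> F" "mon_degree m \<in> A"
  shows "pfun A (\<lambda>v. c * monom_val m v)"
  unfolding pfun_def
  by (rule exI[of _ "Poly_Mapping.single m c"])
    (use assms in \<open>auto simp: mpoly_over_def meval_single lookup_single when_def\<close>)

lemma pfun_sum [intro]:
  assumes "\<And>i. i \<in> I \<Longrightarrow> pfun A (\<phi> i)"
  shows "pfun A (\<lambda>v. \<Sum>i\<in>I. \<phi> i v)"
  using assms by (induction I rule: infinite_finite_induct) auto

lemma pfun_const: "c \<in> F \<Longrightarrow> 0 \<in> A \<Longrightarrow> pfun A (\<lambda>v. c)"
  using pfun_single[of c 0 A] by (simp add: mon_degree_def)

lemma pfun_coord:
  fixes i :: "'n::finite"
  shows "1 \<in> A \<Longrightarrow> pfun A (\<lambda>v. v $ i)"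
proof -
  assume "1 \<in> A"
  moreover have "monom_val (Poly_Mapping.single i 1) v = v $ i" for v :: "complex ^ 'n"
  proof -
    have "monom_val (Poly_Mapping.single i 1) v = (\<Prod>j\<in>UNIV. if j = i then v $ j else 1)"
      by (intro prod.cong) (auto simp: lookup_single when_def)
    then show ?thesis by simp
  qed
  moreover have "mon_degree (Poly_Mapping.single i 1) = 1"
  proof -
    have "mon_degree (Poly_Mapping.single i (1::nat)) = (\<Sum>j\<in>UNIV. if j = i then 1 else 0)"
      unfolding mon_degree_def by (intro sum.cong) (auto simp: lookup_single when_def)
    then show ?thesis by simp
  qed
  ultimately show ?thesis
    using pfun_single[of 1 "Poly_Mapping.single i 1" A] by simp
qed

lemma pfun_mult:
  assumes "pfun A \<phi>" "pfun B \<psi>" and AB: "\<And>a b. a \<in> A \<Longrightarrow> b \<in> B \<Longrightarrow> a + b \<in> C"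
  shows "pfun C (\<lambda>v. \<phi> v * \<psi> v)"
proof -
  obtain f where f: "mpoly_over F f" "\<forall>m\<in>Poly_Mapping.keys f. mon_degree m \<in> A" "\<forall>v. \<phi> v = meval f v"
    using assms(1) unfolding pfun_def by blast
  obtain g where g: "mpoly_over F g" "\<forall>m\<in>Poly_Mapping.keys g. mon_degree m \<in> B" "\<forall>v. \<psi> v = meval g v"
    using assms(2) unfolding pfun_def by blast
  have eq: "(\<lambda>v. \<phi> v * \<psi> v) = (\<lambda>v. \<Sum>m\<in>Poly_Mapping.keys f. \<Sum>n\<in>Poly_Mapping.keys g.
      (Poly_Mapping.lookup f m * Poly_Mapping.lookup g n) * monom_val (m + n) v)"
    unfolding monom_val_add using f(3) g(3)
    by (simp add: meval_def sum_product mult_ac)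
  show ?thesis unfolding eq
    using f g by (intro pfun_sum pfun_single) (auto simp: mpoly_over_def mon_degree_add AB)
qed

lemma pfun_smult: "c \<in> F \<Longrightarrow> pfun A \<phi> \<Longrightarrow> pfun A (\<lambda>v. c * \<phi> v)"
  by (rule pfun_mult[of "{0}" "\<lambda>_. c" A]) (auto intro: pfun_const)

lemma pfun_uminus: "pfun A \<phi> \<Longrightarrow> pfun A (\<lambda>v. - \<phi> v)"
  using pfun_smult[of "- 1" A \<phi>] by simp

lemma pfun_diff: "pfun A \<phi> \<Longrightarrow> pfun A \<psi> \<Longrightarrow> pfun A (\<lambda>v. \<phi> v - \<psi> v)"
  using pfun_add[of A \<phi> "\<lambda>v. - \<psi> v"] pfun_uminus[of A \<psi>] by simp

lemma pfun_UNIV_mult: "pfun UNIV \<phi> \<Longrightarrow> pfun UNIV \<psi> \<Longrightarrow> pfun UNIV (\<lambda>v. \<phi> v * \<psi> v)"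
  by (rule pfun_mult) auto

lemma pfun_prod_hom:
  assumes "finite I" "\<And>i. i \<in> I \<Longrightarrow> pfun {e i} (\<phi> i)"
  shows "pfun {\<Sum>i\<in>I. e i} (\<lambda>v. \<Prod>i\<in>I. \<phi> i v)"
  using assms
proof (induction I rule: finite_induct)
  case (insert i I)
  then have "pfun {e i + (\<Sum>i\<in>I. e i)} (\<lambda>v. \<phi> i v * (\<Prod>i\<in>I. \<phi> i v))"
    by (intro pfun_mult[of "{e i}" _ "{\<Sum>i\<in>I. e i}"]) auto
  then show ?case using insert by simp
qed (auto intro: pfun_const)

lemma pfun_power_hom: "pfun {1} \<phi> \<Longrightarrow> pfun {n} (\<lambda>v. \<phi> v ^ n)"
  using pfun_prod_hom[of "{..<n}" "\<lambda>_. 1" "\<lambda>_. \<phi>"] by simp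

lemma pfun_rename:
  assumes "pfun A \<phi>"
  shows "pfun A (\<lambda>v. \<phi> (\<chi> j. v $ \<sigma> j))"
proof -
  obtain f where f: "mpoly_over F f" "\<forall>m\<in>Poly_Mapping.keys f. mon_degree m \<in> A" "\<forall>v. \<phi> v = meval f v"
    using assms unfolding pfun_def by blast
  have "pfun A (\<lambda>v. meval f (\<chi> j. v $ \<sigma> j))"
    unfolding meval_def
  proof (intro pfun_sum pfun_smult)
    fix m assume m: "m \<in> Poly_Mapping.keys f"
    have "pfun {mon_degree m} (\<lambda>v. \<Prod>j\<in>UNIV. (v $ \<sigma> j) ^ Poly_Mapping.lookup m j)"
      unfolding mon_degree_def by (intro pfun_prod_hom pfun_power_hom pfun_coord) auto
    then show "pfun A (\<lambda>v. \<Prod>j\<in>UNIV. ((\<chi> j. v $ \<sigma> j) $ j) ^ Poly_Mapping.lookup m j)"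
      using f(2) m by (auto intro: pfun_mono)
  qed (use f(1) in \<open>auto simp: mpoly_over_def\<close>)
  then show ?thesis using f by simp
qed

lemma pfun_prod:
  assumes "\<And>i. i \<in> I \<Longrightarrow> pfun UNIV (\<phi> i)"
  shows "pfun UNIV (\<lambda>v. \<Prod>i\<in>I. \<phi> i v)"
  using assms
  by (induction I rule: infinite_finite_induct) (auto intro: pfun_const pfun_UNIV_mult)

lemma pfun_power: "pfun UNIV \<phi> \<Longrightarrow> pfun UNIV (\<lambda>v. \<phi> v ^ n)"
  by (induction n) (auto intro: pfun_const pfun_UNIV_mult)

lemma pfun_compose:
  assumes "pfun UNIV \<phi>" "\<And>j. pfun UNIV (\<lambda>v. \<psi> v $ j)"
  shows "pfun UNIV (\<lambda>v. \<phi> (\<psi> v))"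
proof -
  obtain f where f: "mpoly_over F f" "\<forall>v. \<phi> v = meval f v"
    using assms(1) unfolding pfun_def by blast
  have "pfun UNIV (\<lambda>v. meval f (\<psi> v))"
    unfolding meval_def using f assms(2)
    by (intro pfun_sum pfun_smult pfun_prod pfun_power) (auto simp: mpoly_over_def)
  then show ?thesis using f by simp
qed

lemma pfun_scale:
  assumes "pfun {k} \<phi>"
  shows "\<phi> (c *s v) = c ^ k * \<phi> v"
proof -
  obtain f where f: "\<forall>m\<in>Poly_Mapping.keys f. mon_degree m \<in> {k}" "\<forall>v. \<phi> v = meval f v"
    using assms unfolding pfun_def by blast
  have "monom_val m (c *s v) = c ^ mon_degree m * monom_val m v" for m
    by (simp add: power_mult_distrib prod.distrib mon_degree_def power_sum)
  then show ?thesis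
    using f by (simp add: meval_def sum_distrib_left mult_ac)
qed

text \<open>
  Restricting a polynomial function to a polynomially parametrized curve gives a univariate
  polynomial, which vanishes as soon as it has infinitely many zeros.
\<close>
lemma pfun_along_polys:
  assumes "pfun A \<phi>"
  obtains r where "\<And>t. poly r t = \<phi> (\<chi> i. poly (P $ i) t)"
proof -
  obtain f where f: "\<forall>v. \<phi> v = meval f v"
    using assms unfolding pfun_def by blast
  show ?thesis
    by (rule that[of "\<Sum>m\<in>Poly_Mapping.keys f. smult (Poly_Mapping.lookup f m)
        (\<Prod>i\<in>UNIV. (P $ i) ^ Poly_Mapping.lookup m i)"])
      (simp add: f meval_def poly_sum poly_prod)
qed

text \<open>
  Forms are produced as determinants of matrices of linear forms: the Leibniz formula is a sum of
  products of \<open>n\<close> entries.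
\<close>
lemma pfun_det:
  assumes "\<And>i j. i < n \<Longrightarrow> j < n \<Longrightarrow> pfun {1} (a i j)"
  shows "pfun {n} (\<lambda>v. Determinant.det (Matrix.mat n n (\<lambda>(i, j). a i j v)))"
proof -
  have eq: "Determinant.det (Matrix.mat n n (\<lambda>(i, j). a i j v)) =
      (\<Sum>p\<in>{p. p permutes {0..<n}}. signof p * (\<Prod>i\<in>{0..<n}. a i (p i) v))" for v
    by (subst Determinant.det_def'[of _ n])
      (auto intro!: sum.cong prod.cong dest: permutes_in_image)
  show ?thesis unfolding eq
  proof (intro pfun_sum pfun_smult)
    fix p assume "p \<in> {p. p permutes {0..<n}}"
    then show "pfun {n} (\<lambda>v. \<Prod>i\<in>{0..<n}. a i (p i) v)"
      using pfun_prod_hom[of "{0..<n}" "\<lambda>_. 1" "\<lambda>i. a i (p i)"] assms permutes_in_image[of p "{0..<n}"] by auto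
  qed (auto simp: sign_def)
qed

section \<open>Zariski closures\<close>

lemma mem_aff_space: "v \<in> aff_space F \<longleftrightarrow> (\<forall>i. v $ i \<in> F)"
  by (simp add: aff_space_def)

lemma zclosure_pfun:
  assumes "v \<in> zclosure F A" "pfun B \<phi>" "\<And>a. a \<in> A \<Longrightarrow> \<phi> a = 0"
  shows "\<phi> v = 0"
  using assms by (auto simp: pfun_def zclosure_def zeros_def)

lemma zclosureI:
  assumes "v \<in> aff_space F"
    and "\<And>f. mpoly_over F f \<Longrightarrow> (\<And>a. a \<in> A \<Longrightarrow> meval f a = 0) \<Longrightarrow> meval f v = 0"
  shows "v \<in> zclosure F A"
  using assms by (auto simp: zclosure_def zeros_def)

lemma zclosure_subset_aff: "zclosure F A \<subseteq> aff_space F"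
  by (auto simp: zclosure_def zeros_def)

lemma zclosed_zclosure: "zclosed F (zclosure F A)"
  unfolding zclosed_def zclosure_def
  by (rule exI[of _ "{f. mpoly_over F f \<and> (\<forall>a\<in>A. meval f a = 0)}"]) auto

lemma subset_zclosure: "A \<subseteq> aff_space F \<Longrightarrow> A \<subseteq> zclosure F A"
  by (auto simp: zclosure_def zeros_def)

lemma zclosure_minimal:
  assumes "zclosed F B" "A \<subseteq> B"
  shows "zclosure F A \<subseteq> B"
proof
  fix v assume v: "v \<in> zclosure F A"
  obtain S where S: "\<forall>f\<in>S. mpoly_over F f" "B = zeros F S"
    using assms(1) by (auto simp: zclosed_def)
  have "meval f v = 0" if "f \<in> S" for f
    by (rule zclosure_pfun[OF v pfun_meval]) (use S assms(2) that in \<open>auto simp: zeros_def\<close>)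
  then show "v \<in> B"
    using S(2) v zclosure_subset_aff by (auto simp: zeros_def)
qed

lemma zclosed_pfun_zeros:
  assumes "pfun A \<phi>"
  shows "zclosed F {v \<in> aff_space F. \<phi> v = 0}"
proof -
  obtain f where f: "mpoly_over F f" "\<forall>v. \<phi> v = meval f v"
    using assms unfolding pfun_def by blast
  show ?thesis unfolding zclosed_def
    by (rule exI[of _ "{f}"]) (auto simp: zeros_def f)
qed

lemma zclosure_singleton:
  assumes "v \<in> aff_space F"
  shows "zclosure F {v} = {v}"
proof
  show "zclosure F {v} \<subseteq> {v}"
  proof
    fix u assume u: "u \<in> zclosure F {v}"
    have "u $ i - v $ i = 0" for i
      by (rule zclosure_pfun[OF u, of UNIV "\<lambda>u. u $ i - v $ i"])
        (use assms in \<open>auto intro!: pfun_diff pfun_coord pfun_const simp: mem_aff_space\<close>)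
    then show "u \<in> {v}" by (simp add: vec_eq_iff)
  qed
  show "{v} \<subseteq> zclosure F {v}" using assms by (intro subset_zclosure) auto
qed

end

section \<open>Images of rational parametrizations\<close>

lemma poly_eq_sum_lessThan:
  fixes p :: "complex poly"
  assumes "degree p < n"
  shows "poly p t = (\<Sum>l<n. coeff p l * t ^ l)"
  unfolding poly_altdef
  by (rule sum.mono_neutral_left) (use assms in \<open>auto simp: coeff_eq_0\<close>)

lemma mat_mult_vec_index:
  assumes "i < n"
  shows "Matrix.vec_index (Matrix.mat n n a *\<^sub>v Matrix.vec n x) i = (\<Sum>l<n. a (i, l) * x l)"
  using assms by (simp add: scalar_prod_def atLeast0LessThan)

context rel_alg_closed
begin

text \<open>
  The image of the projective line under a map without base points is Zariski closed.  The hypotheses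
  \<open>not_finite\<close> and \<open>not_inf\<close> say that \<open>V\<close> is neither the image of a finite parameter nor the image of
  the parameter \<open>\<infinity>\<close>, whose coordinates are the coefficients in degree \<open>d\<close>; \<open>not_finite\<close> also excludes
  base points.  The form \<open>\<phi>\<close> that separates \<open>V\<close> from the image is the determinant of a matrix of linear
  forms with the vector \<open>(1, t, \<dots>, t^d)\<close> in its kernel at the point with parameter \<open>t\<close>.
\<close>
lemma image_of_proper_param_closed:
  fixes P :: "complex poly ^ 'm::finite"
  assumes over: "\<And>i. poly_over F (P $ i)" and deg: "\<And>i. degree (P $ i) \<le> d"
    and V: "V \<in> aff_space F" "V \<noteq> 0"
    and not_finite: "\<And>t. t \<in> F \<Longrightarrow> \<exists>i j. V $ i * poly (P $ j) t \<noteq> V $ j * poly (P $ i) t"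
    and not_inf: "\<exists>i j. V $ i * coeff (P $ j) d \<noteq> V $ j * coeff (P $ i) d"
  obtains \<phi> k where "pfun {k} \<phi>" "\<phi> V \<noteq> 0" "\<And>t. \<phi> (\<chi> i. poly (P $ i) t) = 0"
proof -
  obtain c where c: "V $ c \<noteq> 0"
    using V(2) by (auto simp: vec_eq_iff)
  have propor: "V $ i * y j = V $ j * y i" if "\<And>j. V $ c * y j = V $ j * y c" for y :: "'m \<Rightarrow> complex" and i j
  proof -
    have "V $ c * (V $ i * y j) = V $ c * (V $ j * y i)"
      using that[of i] that[of j] by (metis mult.left_commute)
    then show ?thesis using c by simp
  qed
  \<comment> \<open>A common zero of the \<open>A j\<close> would be a parameter of \<open>V\<close>.\<close>
  define A where "A j = smult (V $ c) (P $ j) - smult (V $ j) (P $ c)" for j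
  have A_over: "poly_over F (A j)" for j
    unfolding A_def using over V(1) by (simp add: mem_aff_space)
  have A_deg: "degree (A j) \<le> d" for j
    unfolding A_def using deg by (intro degree_diff_le order_trans[OF degree_smult_le]) auto
  obtain j0 where j0: "coeff (A j0) d \<noteq> 0"
    using not_inf propor[of "\<lambda>j. coeff (P $ j) d"] by (auto simp: A_def)
  then have j0': "A j0 \<noteq> 0" "degree (A j0) = d"
    using A_deg[of j0] le_degree[of "A j0" d] by auto
  have no_common: "g dvd f" if g: "\<And>j. g dvd A j" for g f
  proof -
    have g0: "g \<noteq> 0" using g[of j0] j0' by auto
    have "degree g = 0"
    proof (rule ccontr)
      assume "degree g \<noteq> 0"
      then obtain t where "poly g t = 0"
        using fundamental_theorem_of_algebra[of g] by (auto simp: constant_degree)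
      then have t: "poly (A j) t = 0" for j
        using g[of j] by (metis dvd_trans poly_eq_0_iff_dvd)
      then have "t \<in> F"
        using root_mem j0'(1) A_over by blast
      then show False
        using not_finite[of t] propor[of "\<lambda>j. poly (P $ j) t"] t by (auto simp: A_def)
    qed
    then have "is_unit g" using g0 by (simp add: is_unit_iff_degree)
    then show ?thesis by (rule unit_imp_dvd)
  qed
  have "\<exists>R. (\<forall>j. poly_over F (R j) \<and> degree (R j) \<le> d) \<and> P $ c * monom 1 i = (\<Sum>j\<in>UNIV. A j * R j)"
    if "i \<le> d" for i
  proof -
    have fi: "degree (P $ c * monom 1 i) \<le> d + d"
      using degree_mult_le[of "P $ c" "monom 1 i"] deg[of c] that by (simp add: degree_monom_eq)
    obtain R where "\<forall>j\<in>UNIV. poly_over F (R j) \<and> degree (R j) \<le> d"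
      "P $ c * monom 1 i = (\<Sum>j\<in>UNIV. A j * R j)"
      by (rule bezout_degree_bound[of UNIV A "P $ c * monom 1 i" d j0 d])
        (use fi over A_over A_deg j0' in \<open>auto intro: no_common\<close>)
    then show ?thesis by blast
  qed
  then obtain R where R: "\<And>i j. i \<le> d \<Longrightarrow> poly_over F (R i j)" "\<And>i j. i \<le> d \<Longrightarrow> degree (R i j) \<le> d"
    "\<And>i. i \<le> d \<Longrightarrow> P $ c * monom 1 i = (\<Sum>j\<in>UNIV. A j * R i j)"
    by metis
  \<comment> \<open>The identity for \<open>P $ c * monom 1 i\<close>, read as a linear relation between the powers \<open>t ^ l\<close> whose
    coefficients are linear in the coordinates of the point.\<close>
  define a where "a i l v = (if i = l then 1 else 0) * v $ c -
      (\<Sum>j\<in>UNIV. coeff (R i j) l * (V $ c * v $ j - V $ j * v $ c))" for i l and v :: "complex ^ 'm"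
  define \<phi> where "\<phi> v = Determinant.det (Matrix.mat (Suc d) (Suc d) (\<lambda>(i, l). a i l v))" for v
  show ?thesis
  proof (rule that[of "Suc d" \<phi>])
    show "pfun {Suc d} \<phi>"
      unfolding \<phi>_def
    proof (rule pfun_det)
      fix i l assume "i < Suc d" "l < Suc d"
      then show "pfun {1} (a i l)"
        unfolding a_def using V(1) R(1)
        by (intro pfun_diff pfun_sum pfun_smult pfun_coord) (auto simp: mem_aff_space)
    qed
    have "Matrix.mat (Suc d) (Suc d) (\<lambda>(i, l). a i l V) = V $ c \<cdot>\<^sub>m 1\<^sub>m (Suc d)"
      by (rule eq_matI) (auto simp: a_def)
    then show "\<phi> V \<noteq> 0"
      using c by (simp add: \<phi>_def)
    fix t
    define M where "M = Matrix.mat (Suc d) (Suc d) (\<lambda>(i, l). a i l (\<chi> i. poly (P $ i) t))"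
    define x where "x = Matrix.vec (Suc d) (\<lambda>l. t ^ l)"
    have "M *\<^sub>v x = 0\<^sub>v (Suc d)"
    proof (rule eq_vecI)
      fix i assume "i < dim_vec (0\<^sub>v (Suc d) :: complex Matrix.vec)"
      then have i: "i < Suc d" by simp
      have "Matrix.vec_index (M *\<^sub>v x) i = (\<Sum>l<Suc d. a i l (\<chi> i. poly (P $ i) t) * t ^ l)"
        unfolding M_def x_def using i by (subst mat_mult_vec_index) auto
      also have "\<dots> = (\<Sum>l<Suc d. (if i = l then poly (P $ c) t * t ^ l else 0)) -
          (\<Sum>l<Suc d. \<Sum>j\<in>UNIV. poly (A j) t * (coeff (R i j) l * t ^ l))"
        unfolding sum_subtractf[symmetric]
        by (intro sum.cong) (auto simp: a_def A_def algebra_simps sum_distrib_left sum_subtractf intro!: sum.cong)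
      also have "(\<Sum>l<Suc d. if i = l then poly (P $ c) t * t ^ l else 0) = poly (P $ c) t * t ^ i"
        using i by (simp del: sum.lessThan_Suc)
      also have "(\<Sum>l<Suc d. \<Sum>j\<in>UNIV. poly (A j) t * (coeff (R i j) l * t ^ l)) =
          (\<Sum>j\<in>UNIV. poly (A j) t * (\<Sum>l<Suc d. coeff (R i j) l * t ^ l))"
        by (subst sum.swap) (simp add: sum_distrib_left del: sum.lessThan_Suc)
      also have "poly (P $ c) t * t ^ i - \<dots> = poly (P $ c * monom 1 i) t - (\<Sum>j\<in>UNIV. poly (A j) t * poly (R i j) t)"
        using i R(2) by (simp add: poly_monom poly_eq_sum_lessThan[of _ "Suc d"] less_Suc_eq_le del: sum.lessThan_Suc)
      also have "\<dots> = 0"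
        using i R(3)[of i] by (simp add: poly_sum)
      finally show "Matrix.vec_index (M *\<^sub>v x) i = Matrix.vec_index (0\<^sub>v (Suc d)) i"
        using i by simp
    qed (simp add: M_def)
    moreover have "x \<noteq> 0\<^sub>v (Suc d)"
    proof
      assume "x = 0\<^sub>v (Suc d)"
      then have "Matrix.vec_index x 0 = 0" by simp
      then show False by (simp add: x_def)
    qed
    ultimately show "\<phi> (\<chi> i. poly (P $ i) t) = 0"
      unfolding \<phi>_def M_def[symmetric]
      by (subst det_0_iff_vec_prod_zero[of _ "Suc d"]) (auto simp: M_def x_def intro!: exI[of _ x])
  qed
qed

text \<open>
  If the point with parameter \<open>\<xi>\<close> has no other parameter and the map is unramified at \<open>\<xi>\<close>, then the map
  is generically injective, with an inverse given by a quotient of two forms.  The hypothesis \<open>unram\<close>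
  is this condition for finite parameters: the only common zero of the polynomials in it is \<open>\<xi>\<close>, and it is
  simple.  The hypothesis \<open>j0\<close> says that \<open>\<infinity>\<close> is not another parameter of the point.  As in the proof
  that the image is closed, Bezout's identity leads to linear relations between powers of \<open>t\<close>.  Their
  constant terms are moved to the right-hand side, and Cramer's rule is applied to the unknown \<open>t\<close>.
\<close>
lemma inverse_of_param_unramified_at:
  fixes P :: "complex poly ^ 'm::finite"
  assumes over: "\<And>i. poly_over F (P $ i)" and deg: "\<And>i. degree (P $ i) \<le> d"
    and \<xi>: "\<xi> \<in> F" and c: "poly (P $ c) \<xi> \<noteq> 0" and d: "d > 0"
    and j0: "poly (P $ c) \<xi> * coeff (P $ j0) d \<noteq> poly (P $ j0) \<xi> * coeff (P $ c) d"
    and unram: "\<And>g. (\<And>j. g dvd smult (poly (P $ c) \<xi>) (P $ j) - smult (poly (P $ j) \<xi>) (P $ c))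
      \<Longrightarrow> g dvd [:- \<xi>, 1:]"
  obtains num den where "pfun {d} num" "pfun {d} den" "den (\<chi> i. poly (P $ i) \<xi>) \<noteq> 0"
    "\<And>t. num (\<chi> i. poly (P $ i) t) = t * den (\<chi> i. poly (P $ i) t)"
proof -
  define V where "V = (\<chi> i. poly (P $ i) \<xi>)"
  have V: "V $ i = poly (P $ i) \<xi>" for i by (simp add: V_def)
  define A where "A j = smult (V $ c) (P $ j) - smult (V $ j) (P $ c)" for j
  have A_over: "poly_over F (A j)" for j
    unfolding A_def V using over \<xi> by simp
  have A_deg: "degree (A j) \<le> d" for j
    unfolding A_def using deg by (intro degree_diff_le order_trans[OF degree_smult_le]) auto
  have "coeff (A j0) d \<noteq> 0"
    using j0 by (simp add: A_def V)
  then have j0': "A j0 \<noteq> 0" "degree (A j0) = d"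
    using A_deg[of j0] le_degree[of "A j0" d] by auto
  define f where "f i = P $ c * (monom 1 i * [:- \<xi>, 1:])" for i
  have "\<exists>R. (\<forall>j. poly_over F (R j) \<and> degree (R j) \<le> d) \<and> f i = (\<Sum>j\<in>UNIV. A j * R j)"
    if "i < d" for i
  proof -
    have "degree (monom (1 :: complex) i * [:- \<xi>, 1:]) \<le> d"
      using degree_mult_le[of "monom (1 :: complex) i" "[:- \<xi>, 1:]"] that by (simp add: degree_monom_eq)
    then have fi: "degree (f i) \<le> d + d"
      unfolding f_def using degree_mult_le[of "P $ c" "monom 1 i * [:- \<xi>, 1:]"] deg[of c] by linarith
    have fi_over: "poly_over F (f i)"
      unfolding f_def using over \<xi> by (intro poly_over_mult) auto
    have fi_dvd: "g dvd f i" if "\<forall>j\<in>UNIV. g dvd A j" for g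
      unfolding f_def using unram[of g] that by (intro dvd_mult) (auto simp: A_def V simp del: mult_pCons_right)
    obtain R where "\<forall>j\<in>UNIV. poly_over F (R j) \<and> degree (R j) \<le> d"
      "f i = (\<Sum>j\<in>UNIV. A j * R j)"
      by (rule bezout_degree_bound[of UNIV A "f i" d j0 d]) (use fi fi_over fi_dvd A_over A_deg j0' in auto)
    then show ?thesis by blast
  qed
  then obtain R where R: "\<And>i j. i < d \<Longrightarrow> poly_over F (R i j)" "\<And>i j. i < d \<Longrightarrow> degree (R i j) \<le> d"
    "\<And>i. i < d \<Longrightarrow> f i = (\<Sum>j\<in>UNIV. A j * R i j)"
    by metis
  define \<alpha> where "\<alpha> j v = V $ c * v $ j - V $ j * v $ c" for j and v :: "complex ^ 'm"
  \<comment> \<open>Row \<open>i\<close> is the relation for \<open>f i\<close>, and column \<open>l\<close> belongs to the unknown \<open>t ^ Suc l\<close>.  The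
    right-hand side \<open>b\<close> collects the multiples of \<open>t ^ 0\<close>.\<close>
  define a where "a i l v = ((if i = l then 1 else 0) - (if i = Suc l then \<xi> else 0)) * v $ c -
      (\<Sum>j\<in>UNIV. coeff (R i j) (Suc l) * \<alpha> j v)" for i l v
  define b where "b i v = (if i = 0 then \<xi> else 0) * v $ c + (\<Sum>j\<in>UNIV. coeff (R i j) 0 * \<alpha> j v)" for i v
  define den where "den v = Determinant.det (Matrix.mat d d (\<lambda>(i, l). a i l v))" for v
  define num where "num v = Determinant.det (Matrix.mat d d (\<lambda>(i, l). (if l = 0 then b i else a i l) v))" for v
  have V_F: "V $ i \<in> F" for i using over \<xi> by (simp add: V)
  have pfun_\<alpha>: "pfun {1} (\<alpha> j)" for j
    unfolding \<alpha>_def using V_F by (intro pfun_diff pfun_smult) (auto intro: pfun_coord)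
  have pfun_a: "pfun {1} (a i l)" if "i < d" for i l
    unfolding a_def
    by (intro pfun_diff pfun_sum pfun_smult pfun_coord pfun_\<alpha>; use R(1) that \<xi> in simp)
  have pfun_b: "pfun {1} (b i)" if "i < d" for i
    unfolding b_def
    by (intro pfun_add pfun_sum pfun_smult pfun_coord pfun_\<alpha>; use R(1) that \<xi> in simp)
  show ?thesis
  proof (rule that[of num den])
    show "pfun {d} den" unfolding den_def by (rule pfun_det) (rule pfun_a)
    show "pfun {d} num" unfolding num_def by (rule pfun_det) (simp add: pfun_a[simplified] pfun_b[simplified])
    have "\<alpha> j V = 0" for j by (simp add: \<alpha>_def)
    then have aV: "a i l V = ((if i = l then 1 else 0) - (if i = Suc l then \<xi> else 0)) * V $ c" for i l
      by (simp add: a_def)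
    \<comment> \<open>At \<open>\<xi>\<close> the \<open>\<alpha> j\<close> vanish, and what is left of the matrix is lower bidiagonal.\<close>
    have "den V = prod_list (diag_mat (Matrix.mat d d (\<lambda>(i, l). a i l V)))"
      unfolding den_def by (rule det_lower_triangular[of d]) (auto simp: aV)
    also have "\<dots> = (\<Prod>i = 0..<d. V $ c)"
      by (subst prod_list_diag_prod) (auto simp: aV)
    finally show "den (\<chi> i. poly (P $ i) \<xi>) \<noteq> 0"
      using c by (simp add: V V_def[symmetric])
    fix t
    define v where "v = (\<chi> i. poly (P $ i) t)"
    define M where "M = Matrix.mat d d (\<lambda>(i, l). a i l v)"
    define x where "x = Matrix.vec d (\<lambda>l. t ^ Suc l)"
    have Mx: "Matrix.vec_index (M *\<^sub>v x) i = b i v" if i: "i < d" for i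
    proof -
      have av: "\<alpha> j v = poly (A j) t" for j by (simp add: \<alpha>_def A_def v_def)
      have "Matrix.vec_index (M *\<^sub>v x) i = (\<Sum>l<d. a i l v * t ^ Suc l)"
        unfolding M_def x_def using i by (subst mat_mult_vec_index) auto
      also have "\<dots> = (\<Sum>l<d. (if i = l then v $ c * t ^ Suc l else 0)) -
          (\<Sum>l<d. (if i = Suc l then \<xi> * v $ c * t ^ Suc l else 0)) -
          (\<Sum>l<d. \<Sum>j\<in>UNIV. \<alpha> j v * (coeff (R i j) (Suc l) * t ^ Suc l))"
        unfolding sum_subtractf[symmetric]
        by (intro sum.cong) (auto simp: a_def algebra_simps sum_distrib_left intro!: sum.cong)
      also have "(\<Sum>l<d. (if i = Suc l then \<xi> * v $ c * t ^ Suc l else 0)) =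
          (if i = 0 then 0 else \<xi> * v $ c * t ^ i)"
        using i by (cases i) auto
      also have "(\<Sum>l<d. (if i = l then v $ c * t ^ Suc l else 0)) = v $ c * t ^ Suc i"
        using i by simp
      also have "(\<Sum>l<d. \<Sum>j\<in>UNIV. \<alpha> j v * (coeff (R i j) (Suc l) * t ^ Suc l)) =
          (\<Sum>j\<in>UNIV. \<alpha> j v * (\<Sum>l<d. coeff (R i j) (Suc l) * t ^ Suc l))"
        by (subst sum.swap) (simp add: sum_distrib_left)
      also have "\<dots> = (\<Sum>j\<in>UNIV. \<alpha> j v * (poly (R i j) t - coeff (R i j) 0))"
        using i R(2) by (simp add: poly_eq_sum_lessThan[of _ "Suc d"] less_Suc_eq_le sum.lessThan_Suc_shift
            del: sum.lessThan_Suc)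
      also have "\<dots> = poly (f i) t - (\<Sum>j\<in>UNIV. coeff (R i j) 0 * \<alpha> j v)"
        using i R(3)[of i] by (simp add: av poly_sum right_diff_distrib sum_subtractf mult_ac)
      also have "poly (f i) t = v $ c * t ^ Suc i - \<xi> * v $ c * t ^ i"
        by (simp add: f_def v_def poly_monom algebra_simps)
      finally show ?thesis
        by (simp add: b_def)
    qed
    have "num v = Determinant.det (replace_col M (M *\<^sub>v x) 0)"
      unfolding num_def replace_col_def
      by (rule arg_cong[of _ _ Determinant.det], rule eq_matI)
        (use Mx in \<open>auto simp: M_def simp del: index_mult_mat_vec\<close>)
    also have "\<dots> = Matrix.vec_index x 0 * Determinant.det M"
      by (rule cramer_lemma_mat[of _ d]) (use d in \<open>auto simp: M_def x_def\<close>)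
    finally show "num (\<chi> i. poly (P $ i) t) = t * den (\<chi> i. poly (P $ i) t)"
      using d by (simp add: den_def M_def x_def v_def)
  qed
qed

end

section \<open>Curves with a proper parametrization\<close>

context rel_alg_closed
begin

lemma proj_pt_eq_iff:
  "proj_pt F v w = proj_pt F v' w' \<longleftrightarrow> (\<exists>c\<in>F. c \<noteq> 0 \<and> v = c *s v' \<and> w = c * w')"
proof
  have h: "hcoords v w = c *s hcoords v' w' \<longleftrightarrow> v = c *s v' \<and> w = c * w'" for c
    by (auto simp: hcoords_def vec_eq_iff split_option_all)
  show "\<exists>c\<in>F. c \<noteq> 0 \<and> v = c *s v' \<and> w = c * w'" if "proj_pt F v w = proj_pt F v' w'"
  proof -
    have "hcoords v w \<in> proj_pt F v w"
      unfolding proj_pt_def by (rule CollectI, rule exI[of _ 1]) simp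
    then show ?thesis
      using that h by (auto simp: proj_pt_def)
  qed
  assume "\<exists>c\<in>F. c \<noteq> 0 \<and> v = c *s v' \<and> w = c * w'"
  then obtain c where c: "c \<in> F" "c \<noteq> 0" and h': "hcoords v w = c *s hcoords v' w'"
    using h by blast
  have "\<exists>e'. e *s hcoords v w = e' *s hcoords v' w' \<and> e' \<in> F \<and> e' \<noteq> 0" if "e \<in> F" "e \<noteq> 0" for e
    using c that h' by (intro exI[of _ "e * c"]) (simp add: vector_smult_assoc)
  moreover have "\<exists>e'. e *s hcoords v' w' = e' *s hcoords v w \<and> e' \<in> F \<and> e' \<noteq> 0" if "e \<in> F" "e \<noteq> 0" for e
    using c that h' by (intro exI[of _ "e / c"]) (simp add: vector_smult_assoc)
  ultimately show "proj_pt F v w = proj_pt F v' w'"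
    unfolding proj_pt_def by fastforce
qed

text \<open>
  The last coordinate of a representative at infinity is 0, so the two conditions in the definition
  can be imposed on the same representative.
\<close>
lemma mem_pts_at_infinity_iff:
  "\<P> \<in> pts_at_infinity F A \<longleftrightarrow> (\<exists>v. v \<in> aff_space F \<and> v \<noteq> 0 \<and> \<P> = proj_pt F v 0 \<and>
     (\<forall>g. mpoly_over F g \<and> homogeneous g \<and> (\<forall>a\<in>zclosure F A. meval g (hcoords a 1) = 0)
        \<longrightarrow> meval g (hcoords v 0) = 0))" (is "_ \<longleftrightarrow> (\<exists>v. ?R v)")
proof
  assume "\<P> \<in> pts_at_infinity F A"
  then obtain v w v' where v: "\<P> = proj_pt F v w" "v \<in> aff_space F" "v \<noteq> 0 \<or> w \<noteq> 0"
    "\<forall>g. mpoly_over F g \<and> homogeneous g \<and> (\<forall>a\<in>zclosure F A. meval g (hcoords a 1) = 0)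
        \<longrightarrow> meval g (hcoords v w) = 0" "\<P> = proj_pt F v' 0"
    unfolding pts_at_infinity_def proj_closure_def by auto
  then have "w = 0"
    using proj_pt_eq_iff[of v w v' 0] by auto
  then have "?R v" using v by auto
  then show "\<exists>v. ?R v" ..
next
  assume "\<exists>v. ?R v"
  then obtain v where v: "?R v" ..
  then show "\<P> \<in> pts_at_infinity F A"
    unfolding pts_at_infinity_def proj_closure_def
    by (intro IntI CollectI exI[of _ v] exI[of _ 0]) auto
qed

end

text \<open>
  As no \<open>p $ i\<close> has a larger degree than \<open>q\<close>, the parameter \<open>\<infinity>\<close> gives the affine point \<open>pt_inf\<close>, and the
  points at infinity come from the roots of \<open>q\<close>.  Since \<open>p $ k\<close> and \<open>q\<close> are coprime there are no base
  points, and the coordinate \<open>k\<close> is a nonconstant function on the curve.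
\<close>
locale affine_param = rel_alg_closed F for F :: "complex set" +
  fixes p :: "complex poly ^ 'n::finite" and q :: "complex poly" and d :: nat and k :: 'n
  assumes over_p: "poly_over F (p $ i)" and over_q: "poly_over F q"
    and deg_p: "degree (p $ i) \<le> d" and deg_q: "degree q = d" and d_pos: "d > 0"
    and cop: "coprime (p $ k) q"
begin

definition pt :: "complex \<Rightarrow> complex ^ 'n" where
  "pt t = (\<chi> i. poly (p $ i) t / poly q t)"

text \<open>
  The image of the parameter \<open>\<infinity>\<close>.
\<close>
definition pt_inf :: "complex ^ 'n" where
  "pt_inf = (\<chi> i. coeff (p $ i) d / coeff q d)"

definition numerators :: "complex \<Rightarrow> complex ^ 'n" where
  "numerators t = (\<chi> i. poly (p $ i) t)"

definition P :: "complex poly ^ 'n option" where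
  "P = (\<chi> j. case j of None \<Rightarrow> q | Some i \<Rightarrow> p $ i)"

definition curve :: "(complex ^ 'n) set" where
  "curve = param_curve F p q"

lemma q_nz: "q \<noteq> 0" and lc_q: "coeff q d \<noteq> 0"
  using deg_q d_pos by auto

lemma P_simps [simp]: "P $ None = q" "P $ Some i = p $ i"
  by (simp_all add: P_def)

lemma over_P: "poly_over F (P $ j)" and deg_P: "degree (P $ j) \<le> d"
  using over_p over_q deg_p deg_q by (cases j; simp)+

lemma eval_P: "(\<chi> j. poly (P $ j) t) = hcoords (numerators t) (poly q t)"
  by (auto simp: vec_eq_iff hcoords_def P_def numerators_def split: option.splits)

lemma hcoords_numerators: "poly q t \<noteq> 0 \<Longrightarrow> hcoords (numerators t) (poly q t) = poly q t *s hcoords (pt t) 1"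
  by (auto simp: vec_eq_iff hcoords_def numerators_def pt_def split: option.splits)

lemma not_both_zero: "poly q t = 0 \<Longrightarrow> poly (p $ k) t \<noteq> 0"
  using cop coprime_poly_0 by blast

lemma curve_eq: "curve = zclosure F {pt t | t. t \<in> F \<and> poly q t \<noteq> 0}"
  by (simp add: curve_def param_curve_def pt_def)

lemma pt_in_aff: "t \<in> F \<Longrightarrow> pt t \<in> aff_space F"
  using over_p over_q by (auto simp: mem_aff_space pt_def)

lemma pt_in_curve: "t \<in> F \<Longrightarrow> poly q t \<noteq> 0 \<Longrightarrow> pt t \<in> curve"
  unfolding curve_eq using pt_in_aff by (intro subsetD[OF subset_zclosure]) auto

lemma curve_subset_aff: "curve \<subseteq> aff_space F"
  unfolding curve_eq by (rule zclosure_subset_aff)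

lemma zclosure_curve: "zclosure F curve = curve"
  using zclosure_minimal[OF zclosed_zclosure order_refl] subset_zclosure[OF curve_subset_aff]
  unfolding curve_eq by blast

lemma infinite_F_minus: "finite E \<Longrightarrow> infinite (F - E)"
  using infinite_F by simp

lemma exists_F_minus: "finite E \<Longrightarrow> \<exists>t\<in>F. t \<notin> E"
  using infinite_F_minus[of E] infinite_imp_nonempty by blast

lemma poly_eq_0I:
  assumes "finite E" "\<And>t. t \<in> F \<Longrightarrow> t \<notin> E \<Longrightarrow> poly r t = 0"
  shows "r = 0"
proof (rule ccontr)
  assume "r \<noteq> 0"
  then have "finite {t. poly r t = 0}" by (rule poly_roots_finite)
  moreover have "F - E \<subseteq> {t. poly r t = 0}" using assms(2) by auto
  ultimately show False using infinite_F_minus[OF assms(1)] finite_subset by blast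
qed

lemma finite_poles: "finite {t. poly q t = 0}"
  using q_nz by (rule poly_roots_finite)

lemma pfun_dehomogenize:
  assumes "pfun A \<phi>"
  shows "pfun UNIV (\<lambda>v :: complex ^ 'n. \<phi> (hcoords v 1))"
proof (rule pfun_compose)
  show "pfun UNIV (\<lambda>v :: complex ^ 'n. hcoords v 1 $ j)" for j
    by (cases j) (auto simp: hcoords_def intro: pfun_const pfun_coord)
qed (use assms pfun_mono in blast)

text \<open>
  One direction holds because the curve is the closure of its points \<open>pt t\<close>.  The other one extends
  the vanishing from almost all parameters to all of them, in particular to the roots of \<open>q\<close>.
\<close>
lemma hom_vanishes_on_curve_iff:
  assumes "pfun {m} \<phi>"
  shows "(\<forall>v\<in>curve. \<phi> (hcoords v 1) = 0) \<longleftrightarrow> (\<forall>t. \<phi> (hcoords (numerators t) (poly q t)) = 0)"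
proof
  assume L: "\<forall>v\<in>curve. \<phi> (hcoords v 1) = 0"
  obtain r where r: "\<And>t. poly r t = \<phi> (\<chi> j. poly (P $ j) t)"
    using pfun_along_polys[OF assms] by metis
  have "r = 0"
  proof (rule poly_eq_0I[OF finite_poles])
    fix t assume "t \<in> F" "t \<notin> {t. poly q t = 0}"
    then show "poly r t = 0"
      using L pt_in_curve by (simp add: r eval_P hcoords_numerators pfun_scale[OF assms])
  qed
  then show "\<forall>t. \<phi> (hcoords (numerators t) (poly q t)) = 0"
    using r by (simp add: eval_P)
next
  assume R: "\<forall>t. \<phi> (hcoords (numerators t) (poly q t)) = 0"
  have van: "\<phi> (hcoords (pt t) 1) = 0" if "poly q t \<noteq> 0" for t
    using R[rule_format, of t] that by (simp add: hcoords_numerators pfun_scale[OF assms])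
  show "\<forall>v\<in>curve. \<phi> (hcoords v 1) = 0"
  proof
    fix v assume "v \<in> curve"
    then show "\<phi> (hcoords v 1) = 0"
      unfolding curve_eq by (rule zclosure_pfun[OF _ pfun_dehomogenize[OF assms]]) (use van in auto)
  qed
qed

text \<open>
  A point that is neither \<open>pt_inf\<close> nor some \<open>pt t\<close> would be separated from the curve by a form.
\<close>
lemma curve_cases:
  assumes "v \<in> curve"
  shows "v = pt_inf \<or> (\<exists>t\<in>F. poly q t \<noteq> 0 \<and> v = pt t)"
proof (rule ccontr)
  assume neg: "\<not> ?thesis"
  have hv: "hcoords v 1 \<in> aff_space F" "hcoords v 1 \<noteq> 0"
    using assms curve_subset_aff
    by (auto simp: mem_aff_space hcoords_def vec_eq_iff subset_iff split: option.splits)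
  obtain \<phi> m where \<phi>: "pfun {m} \<phi>" "\<phi> (hcoords v 1) \<noteq> 0" "\<And>t. \<phi> (\<chi> i. poly (P $ i) t) = 0"
  proof (rule image_of_proper_param_closed[of P d "hcoords v 1"])
    show "\<exists>i j. hcoords v 1 $ i * poly (P $ j) t \<noteq> hcoords v 1 $ j * poly (P $ i) t" if t: "t \<in> F" for t
    proof (rule ccontr)
      assume "\<not> ?thesis"
      then have A: "hcoords v 1 $ i * poly (P $ j) t = hcoords v 1 $ j * poly (P $ i) t" for i j
        by blast
      have eq: "v $ i * poly q t = poly (p $ i) t" for i
        using A[of "Some i" None] by (simp add: hcoords_def)
      then have "poly q t \<noteq> 0"
        using not_both_zero[of t] by (metis mult_zero_right)
      moreover have "v = pt t"
        using eq \<open>poly q t \<noteq> 0\<close> by (simp add: vec_eq_iff pt_def eq_divide_eq)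
      ultimately show False using neg t by blast
    qed
    show "\<exists>i j. hcoords v 1 $ i * coeff (P $ j) d \<noteq> hcoords v 1 $ j * coeff (P $ i) d"
    proof (rule ccontr)
      assume "\<not> ?thesis"
      then have A: "hcoords v 1 $ i * coeff (P $ j) d = hcoords v 1 $ j * coeff (P $ i) d" for i j
        by blast
      have "v $ i * coeff q d = coeff (p $ i) d" for i
        using A[of "Some i" None] by (simp add: hcoords_def)
      then have "v = pt_inf"
        using lc_q by (simp add: vec_eq_iff pt_inf_def eq_divide_eq)
      then show False using neg by blast
    qed
  qed (use hv over_P deg_P in auto)
  then show False
    using hom_vanishes_on_curve_iff[OF \<phi>(1)] assms by (simp add: eval_P)
qed

lemma pts_at_infinity_curve:
  "pts_at_infinity F curve = {proj_pt F (numerators t) 0 | t. t \<in> F \<and> poly q t = 0}"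
proof (intro Set.set_eqI iffI)
  fix \<P> assume "\<P> \<in> pts_at_infinity F curve"
  then obtain v where v: "v \<in> aff_space F" "v \<noteq> 0" "\<P> = proj_pt F v 0"
    and van: "\<And>g. mpoly_over F g \<Longrightarrow> homogeneous g \<Longrightarrow>
      (\<forall>a\<in>curve. meval g (hcoords a 1) = 0) \<Longrightarrow> meval g (hcoords v 0) = 0"
    unfolding mem_pts_at_infinity_iff zclosure_curve by blast
  obtain l where l: "v $ l \<noteq> 0"
    using v(2) by (auto simp: vec_eq_iff)
  have hv: "hcoords v 0 \<in> aff_space F" "hcoords v 0 \<noteq> 0"
    using v by (auto simp: mem_aff_space hcoords_def vec_eq_iff split_option_ex split: option.splits)
  show "\<P> \<in> {proj_pt F (numerators t) 0 | t. t \<in> F \<and> poly q t = 0}"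
  proof (rule ccontr)
    assume neg: "\<P> \<notin> {proj_pt F (numerators t) 0 | t. t \<in> F \<and> poly q t = 0}"
    obtain \<phi> m where \<phi>: "pfun {m} \<phi>" "\<phi> (hcoords v 0) \<noteq> 0" "\<And>t. \<phi> (\<chi> i. poly (P $ i) t) = 0"
    proof (rule image_of_proper_param_closed[of P d "hcoords v 0"])
      show "\<exists>i j. hcoords v 0 $ i * poly (P $ j) t \<noteq> hcoords v 0 $ j * poly (P $ i) t" if t: "t \<in> F" for t
      proof (rule ccontr)
        assume "\<not> ?thesis"
        then have A: "hcoords v 0 $ i * poly (P $ j) t = hcoords v 0 $ j * poly (P $ i) t" for i j
          by blast
        have "v $ l * poly q t = 0"
          using A[of "Some l" None] by (simp add: hcoords_def)
        then have q0: "poly q t = 0" using l by simp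
        have eq: "v $ l * poly (p $ j) t = v $ j * poly (p $ l) t" for j
          using A[of "Some l" "Some j"] by (simp add: hcoords_def)
        have pl: "poly (p $ l) t \<noteq> 0"
          using eq[of k] not_both_zero[OF q0] l by auto
        have "v = (v $ l / poly (p $ l) t) *s numerators t"
          using eq pl by (simp add: vec_eq_iff numerators_def field_simps)
        then have "proj_pt F v 0 = proj_pt F (numerators t) 0"
          unfolding proj_pt_eq_iff using l pl over_p t v(1)
          by (intro bexI[of _ "v $ l / poly (p $ l) t"]) (auto simp: mem_aff_space)
        then show False using neg t q0 v(3) by blast
      qed
      show "\<exists>i j. hcoords v 0 $ i * coeff (P $ j) d \<noteq> hcoords v 0 $ j * coeff (P $ i) d"
        using l lc_q by (intro exI[of _ "Some l"] exI[of _ None]) (simp add: hcoords_def)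
    qed (use hv over_P deg_P in auto)
    from \<phi>(1) obtain g where g: "mpoly_over F g" "\<forall>m'\<in>Poly_Mapping.keys g. mon_degree m' = m"
      "\<forall>v. \<phi> v = meval g v"
      by (auto simp: pfun_def)
    then have "homogeneous g" by (auto simp: homogeneous_def)
    moreover have "\<forall>a\<in>curve. meval g (hcoords a 1) = 0"
      using hom_vanishes_on_curve_iff[OF \<phi>(1)] \<phi>(3) g(3) by (simp add: eval_P)
    ultimately show False using van g \<phi>(2) by simp
  qed
next
  fix \<P> assume "\<P> \<in> {proj_pt F (numerators t) 0 | t. t \<in> F \<and> poly q t = 0}"
  then obtain t where t: "\<P> = proj_pt F (numerators t) 0" "t \<in> F" "poly q t = 0" by blast
  have aff: "numerators t \<in> aff_space F" using over_p t by (auto simp: mem_aff_space numerators_def)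
  have nz: "numerators t \<noteq> 0" using not_both_zero[OF t(3)] by (auto simp: numerators_def vec_eq_iff)
  have "meval g (hcoords (numerators t) 0) = 0"
    if g: "mpoly_over F g" "homogeneous g" "\<forall>a\<in>curve. meval g (hcoords a 1) = 0" for g
  proof -
    obtain m where "pfun {m} (meval g)"
      using g by (auto simp: homogeneous_def pfun_def)
    then show ?thesis
      using hom_vanishes_on_curve_iff[of m "meval g"] g(3) t(3) by metis
  qed
  then show "\<P> \<in> pts_at_infinity F curve"
    unfolding mem_pts_at_infinity_iff zclosure_curve using t(1) aff nz by blast
qed

text \<open>
  Clearing denominators in a polynomial function along the parametrization.
\<close>
lemma pfun_along_pt:
  assumes "pfun A \<phi>"
  obtains r N where "\<And>t. poly q t \<noteq> 0 \<Longrightarrow> poly r t = poly q t ^ N * \<phi> (pt t)"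
proof -
  obtain f where f: "\<forall>v. \<phi> v = meval f v"
    using assms unfolding pfun_def by blast
  define N where "N = Max (insert 0 (mon_degree ` Poly_Mapping.keys f))"
  have N: "mon_degree m \<le> N" if "m \<in> Poly_Mapping.keys f" for m
    unfolding N_def using that by (intro Max_ge) auto
  define r where "r = (\<Sum>m\<in>Poly_Mapping.keys f. smult (Poly_Mapping.lookup f m)
      (q ^ (N - mon_degree m) * (\<Prod>i\<in>UNIV. (p $ i) ^ Poly_Mapping.lookup m i)))"
  have "poly r t = poly q t ^ N * \<phi> (pt t)" if t: "poly q t \<noteq> 0" for t
  proof -
    have "poly q t ^ (N - mon_degree m) * (\<Prod>i\<in>UNIV. poly (p $ i) t ^ Poly_Mapping.lookup m i) =
        poly q t ^ N * monom_val m (pt t)" if m: "m \<in> Poly_Mapping.keys f" for m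
    proof -
      have "poly q t ^ N = poly q t ^ (N - mon_degree m) * poly q t ^ mon_degree m"
        using N[OF m] by (simp add: power_add[symmetric])
      moreover have "poly q t ^ mon_degree m * monom_val m (pt t) =
          (\<Prod>i\<in>UNIV. poly (p $ i) t ^ Poly_Mapping.lookup m i)"
        using t by (simp add: mon_degree_def power_sum prod.distrib[symmetric] pt_def power_divide)
      ultimately show ?thesis by (simp add: mult.assoc)
    qed
    then show ?thesis
      by (simp add: r_def f meval_def poly_sum poly_prod sum_distrib_left mult_ac)
  qed
  then show ?thesis using that by blast
qed

text \<open>
  The curve is the closure of an image of a cofinite subset of the line: a proper closed subset only
  contains points whose parameters are roots of a fixed nonzero polynomial, and the product of two
  nonzero polynomials has finitely many roots.
\<close>
lemma zirreducible_curve: "zirreducible F curve"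
  unfolding zirreducible_def
proof (intro conjI allI impI)
  show "zclosed F curve" unfolding curve_eq by (rule zclosed_zclosure)
  obtain t where "t \<in> F" "t \<notin> {t. poly q t = 0}"
    using exists_F_minus[OF finite_poles] by blast
  then show "curve \<noteq> {}" using pt_in_curve by blast
  fix A B assume AB: "zclosed F A" "zclosed F B" "curve = A \<union> B"
  show "curve = A \<or> curve = B"
  proof (rule ccontr)
    assume neg: "\<not> ?thesis"
    have *: "\<exists>r. r \<noteq> 0 \<and> (\<forall>t\<in>F. poly q t \<noteq> 0 \<longrightarrow> pt t \<in> C \<longrightarrow> poly r t = 0)"
      if C: "zclosed F C" "C \<subseteq> curve" "curve \<noteq> C" for C
    proof -
      have "\<not> {pt t | t. t \<in> F \<and> poly q t \<noteq> 0} \<subseteq> C"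
        using zclosure_minimal[OF C(1)] C(2,3) unfolding curve_eq by blast
      then obtain t1 where t1: "t1 \<in> F" "poly q t1 \<noteq> 0" "pt t1 \<notin> C" by blast
      obtain S where S: "\<forall>f\<in>S. mpoly_over F f" "C = zeros F S"
        using C(1) by (auto simp: zclosed_def)
      then obtain f where f: "f \<in> S" "meval f (pt t1) \<noteq> 0"
        using t1 pt_in_aff by (auto simp: zeros_def)
      obtain r N where r: "\<And>t. poly q t \<noteq> 0 \<Longrightarrow> poly r t = poly q t ^ N * meval f (pt t)"
        by (rule pfun_along_pt[OF pfun_meval[of f]]) (use S(1) f(1) in auto)
      have "poly r t1 \<noteq> 0" using r t1 f by simp
      moreover have "poly r t = 0" if "poly q t \<noteq> 0" "pt t \<in> C" for t
        using r[OF that(1)] that(2) S f(1) by (auto simp: zeros_def)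
      ultimately show ?thesis by (intro exI[of _ r]) auto
    qed
    have sub: "A \<subseteq> curve" "B \<subseteq> curve" and ne: "curve \<noteq> A" "curve \<noteq> B"
      using AB(3) neg by auto
    obtain r where r: "r \<noteq> 0" "\<forall>t\<in>F. poly q t \<noteq> 0 \<longrightarrow> pt t \<in> A \<longrightarrow> poly r t = 0"
      using *[OF AB(1) sub(1) ne(1)] by metis
    obtain r' where r': "r' \<noteq> 0" "\<forall>t\<in>F. poly q t \<noteq> 0 \<longrightarrow> pt t \<in> B \<longrightarrow> poly r' t = 0"
      using *[OF AB(2) sub(2) ne(2)] by metis
    have "r * r' = 0"
    proof (rule poly_eq_0I[OF finite_poles])
      fix t assume "t \<in> F" "t \<notin> {t. poly q t = 0}"
      then show "poly (r * r') t = 0"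
        using pt_in_curve[of t] AB(3) r(2) r'(2) by auto
    qed
    then show False using r r' by simp
  qed
qed

end

section \<open>Degree and rationality of birationally parametrized curves\<close>

text \<open>
  The degree is the sum of the orders of the roots.
\<close>
lemma rsquarefree_iff_card_roots:
  fixes p :: "complex poly"
  assumes "p \<noteq> 0"
  shows "rsquarefree p \<longleftrightarrow> card {t. poly p t = 0} = degree p"
proof
  assume sf: "rsquarefree p"
  have "degree p = degree (smult (lead_coeff p) (\<Prod>z|poly p z = 0. [:- z, 1:]))"
    using complex_poly_decompose_rsquarefree[OF sf] by simp
  also have "\<dots> = (\<Sum>z|poly p z = 0. degree [:- z, 1:])"
    using assms by (simp add: degree_prod_sum_eq)
  finally show "card {t. poly p t = 0} = degree p" by simp
next
  assume card: "card {t. poly p t = 0} = degree p"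
  let ?R = "{t. poly p t = 0}"
  have fin: "finite ?R" using assms by (rule poly_roots_finite)
  have pos: "order t p \<ge> 1" if "t \<in> ?R" for t
    using that assms order_root[of p t] by simp
  have "order t p = 1" if t: "t \<in> ?R" for t
  proof (rule ccontr)
    assume "order t p \<noteq> 1"
    then have "(\<Sum>x\<in>?R. 1) < (\<Sum>x\<in>?R. order x p)"
      using pos t by (intro sum_strict_mono_ex1 fin) (auto intro!: bexI[of _ t] simp: le_neq_implies_less)
    then show False using sum_order_le_degree[OF assms] card by simp
  qed
  then show "rsquarefree p"
    unfolding rsquarefree_def using assms order_0I by blast
qed

context rel_alg_closed
begin

lemma pfun_poly: "poly_over F r \<Longrightarrow> pfun UNIV (\<lambda>v. poly r (v $ i))"
  unfolding poly_altdef
  by (intro pfun_sum pfun_smult pfun_power pfun_coord) auto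

lemma regular_onI:
  assumes "\<And>i. pfun UNIV (N i)" "\<And>i. pfun UNIV (D i)"
    and "\<And>v i. v \<in> U \<Longrightarrow> D i v \<noteq> 0" "\<And>v i. v \<in> U \<Longrightarrow> \<phi> v $ i = N i v / D i v"
  shows "regular_on F U \<phi>"
proof -
  obtain nm where nm: "\<And>i. mpoly_over F (nm i)" "\<And>i v. N i v = meval (nm i) v"
    using assms(1) unfolding pfun_def by metis
  obtain dn where dn: "\<And>i. mpoly_over F (dn i)" "\<And>i v. D i v = meval (dn i) v"
    using assms(2) unfolding pfun_def by metis
  show ?thesis unfolding regular_on_def
    by (rule exI[of _ nm], rule exI[of _ dn]) (use nm dn assms(3,4) in auto)
qed

end

text \<open>
  The forms \<open>num\<close> and \<open>den\<close> recover the parameter from the point, except at finitely many parameters.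
\<close>
locale birational_param = affine_param F p q d k
  for F and p :: "complex poly ^ 'n::finite" and q d k +
  fixes num den :: "complex ^ 'n option \<Rightarrow> complex" and m :: nat
  assumes pfun_num: "pfun {m} num" and pfun_den: "pfun {m} den"
    and den_nz: "\<exists>t. den (hcoords (numerators t) (poly q t)) \<noteq> 0"
    and num_den: "num (hcoords (numerators t) (poly q t)) = t * den (hcoords (numerators t) (poly q t))"
begin

definition exc :: "complex set" where
  "exc = {t. poly q t = 0 \<or> den (hcoords (numerators t) (poly q t)) = 0}"

lemma finite_exc: "finite exc"
proof -
  obtain r where r: "\<And>t. poly r t = den (\<chi> j. poly (P $ j) t)"
    using pfun_along_polys[OF pfun_den] by metis
  have "r \<noteq> 0" using den_nz r by (metis eval_P poly_0)
  then have "finite ({t. poly q t = 0} \<union> {t. poly r t = 0})"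
    using finite_poles poly_roots_finite by blast
  then show ?thesis
    by (rule finite_subset[rotated]) (auto simp: exc_def r eval_P)
qed

lemma pole_in_exc: "poly q t = 0 \<Longrightarrow> t \<in> exc"
  by (simp add: exc_def)

lemma parameter_of_pt:
  assumes "t \<notin> exc"
  shows "den (hcoords (pt t) 1) \<noteq> 0" "num (hcoords (pt t) 1) / den (hcoords (pt t) 1) = t"
proof -
  have q: "poly q t \<noteq> 0" and dn: "den (hcoords (numerators t) (poly q t)) \<noteq> 0"
    using assms by (auto simp: exc_def)
  show dn': "den (hcoords (pt t) 1) \<noteq> 0"
    using dn by (simp add: hcoords_numerators[OF q] pfun_scale[OF pfun_den])
  have "poly q t ^ m * num (hcoords (pt t) 1) = t * (poly q t ^ m * den (hcoords (pt t) 1))"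
    using num_den[of t] by (simp add: hcoords_numerators[OF q] pfun_scale[OF pfun_den] pfun_scale[OF pfun_num])
  then show "num (hcoords (pt t) 1) / den (hcoords (pt t) 1) = t"
    using q dn' by (simp add: field_simps)
qed

lemma inj_on_pt: "inj_on pt (- exc)"
  by (rule inj_onI) (metis ComplD parameter_of_pt(2))

text \<open>
  Substituting the parametrization into the equation of the hyperplane gives a polynomial \<open>R\<close> of
  degree at most \<open>d\<close>.  Its roots are the parameters of the section, and the degree is less than \<open>d\<close> if the
  hyperplane contains the point \<open>pt_inf\<close>.  The case \<open>R = 0\<close> would put the whole curve, an infinite set,
  into the hyperplane.
\<close>
lemma card_hyperplane_section_le:
  assumes H: "is_hyperplane F H" and fin: "finite (curve \<inter> H)"
  shows "card (curve \<inter> H) \<le> d"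
proof -
  obtain a b where ab: "a \<in> aff_space F" "b \<in> F" "H = {v \<in> aff_space F. (\<Sum>i\<in>UNIV. a $ i * v $ i) = b}"
    using H unfolding is_hyperplane_def by blast
  define R where "R = (\<Sum>i\<in>UNIV. smult (a $ i) (p $ i)) - smult b q"
  have R_pt: "poly R t = poly q t * ((\<Sum>i\<in>UNIV. a $ i * pt t $ i) - b)" if "poly q t \<noteq> 0" for t
    using that by (simp add: R_def poly_sum pt_def right_diff_distrib sum_distrib_left)
  have R_inf: "coeff R d = coeff q d * ((\<Sum>i\<in>UNIV. a $ i * pt_inf $ i) - b)"
    using lc_q by (simp add: R_def coeff_sum pt_inf_def right_diff_distrib sum_distrib_left)
  have "R \<noteq> 0"
  proof
    assume "R = 0"
    then have "pt ` (F - exc) \<subseteq> curve \<inter> H"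
      using R_pt pt_in_curve pt_in_aff pole_in_exc by (auto simp: ab(3))
    then have "finite (pt ` (F - exc))" using fin finite_subset by blast
    moreover have "inj_on pt (F - exc)" using inj_on_pt by (rule inj_on_subset) auto
    ultimately show False using infinite_F_minus[OF finite_exc] finite_imageD by blast
  qed
  then have fr: "finite {t. poly R t = 0}" and cr: "card {t. poly R t = 0} \<le> degree R"
    using poly_roots_finite card_poly_roots_bound by blast+
  have dR: "degree R \<le> d"
    unfolding R_def using deg_p deg_q
    by (intro degree_diff_le degree_sum_le order_trans[OF degree_smult_le]) auto
  define I where "I = (if coeff R d = 0 then {pt_inf} else {})"
  have "curve \<inter> H \<subseteq> pt ` {t. poly R t = 0} \<union> I"
  proof
    fix v assume v: "v \<in> curve \<inter> H"
    then consider "v = pt_inf" | t where "t \<in> F" "poly q t \<noteq> 0" "v = pt t"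
      using curve_cases by blast
    then show "v \<in> pt ` {t. poly R t = 0} \<union> I"
    proof cases
      case 1
      then show ?thesis using v R_inf by (simp add: ab(3) I_def)
    next
      case 2
      then show ?thesis using v R_pt by (auto simp: ab(3))
    qed
  qed
  then have "card (curve \<inter> H) \<le> card (pt ` {t. poly R t = 0} \<union> I)"
    using fr by (intro card_mono) (auto simp: I_def)
  also have "\<dots> \<le> card {t. poly R t = 0} + card I"
    using card_Un_le[of "pt ` {t. poly R t = 0}" I] card_image_le[OF fr, of pt] by simp
  also have "\<dots> \<le> d"
  proof (cases "coeff R d = 0")
    case True
    then have "degree R \<noteq> d" using d_pos \<open>R \<noteq> 0\<close> by auto
    then show ?thesis using cr dR True by (simp add: I_def)
  next
    case False
    then show ?thesis using cr dR by (simp add: I_def)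
  qed
  finally show ?thesis .
qed

text \<open>
  This is the numerator of the derivative of the coordinate \<open>k\<close>.  If it were zero, \<open>q\<close> would divide
  \<open>p $ k * pderiv q\<close>, but at a root of \<open>q\<close> this product has a smaller order than \<open>q\<close>.
\<close>
lemma wronskian_nz: "pderiv (p $ k) * q - p $ k * pderiv q \<noteq> 0"
proof
  assume "pderiv (p $ k) * q - p $ k * pderiv q = 0"
  then have "q dvd p $ k * pderiv q" by (metis dvd_triv_right eq_iff_diff_eq_0)
  moreover obtain t where t: "poly q t = 0"
    using fundamental_theorem_of_algebra[of q] d_pos deg_q by (auto simp: constant_degree)
  have q': "pderiv q \<noteq> 0" using d_pos deg_q by (simp add: pderiv_eq_0_iff)
  have pt: "poly (p $ k) t \<noteq> 0" using not_both_zero[OF t] .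
  then have "p $ k * pderiv q \<noteq> 0" using q' by auto
  ultimately have "order t q \<le> order t (p $ k) + order t (pderiv q)"
    using dvd_imp_order_le order_mult by metis
  moreover have "order t (p $ k) = 0" using pt by (rule order_0I)
  moreover have "order t q = Suc (order t (pderiv q))"
    using q' t q_nz by (intro order_pderiv) (simp_all add: order_root)
  ultimately show False by simp
qed

text \<open>
  The hyperplanes on which the coordinate \<open>k\<close> has a constant value \<open>b\<close> suffice.  A general \<open>b\<close> avoids
  the value at \<open>pt_inf\<close>, the critical values of the coordinate and the parameters at which the
  parametrization might not be injective; then \<open>p $ k - b q\<close> has \<open>d\<close> simple roots, which belong to
  different points.
\<close>
lemma hyperplane_section_attained:
  obtains H where "is_hyperplane F H" "finite (curve \<inter> H)" "card (curve \<inter> H) = d"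
proof -
  define W where "W = pderiv (p $ k) * q - p $ k * pderiv q"
  define B where "B = exc \<union> {t. poly W t = 0}"
  have "finite B"
    unfolding B_def using finite_exc poly_roots_finite[of W] wronskian_nz[folded W_def] by simp
  then obtain b where "b \<in> F" "b \<notin> insert (pt_inf $ k) ((\<lambda>t. pt t $ k) ` B)"
    using exists_F_minus[of "insert (pt_inf $ k) ((\<lambda>t. pt t $ k) ` B)"] by auto
  then have b: "b \<in> F" "b \<noteq> pt_inf $ k" "\<And>t. t \<in> B \<Longrightarrow> b \<noteq> pt t $ k"
    by auto
  define r where "r = p $ k - smult b q"
  have r_over: "poly_over F r" using over_p over_q b(1) by (simp add: r_def)
  have "coeff r d \<noteq> 0"
    using b(2) lc_q by (auto simp: r_def pt_inf_def eq_divide_eq)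
  moreover have "degree r \<le> d"
    unfolding r_def using deg_p deg_q by (intro degree_diff_le order_trans[OF degree_smult_le]) auto
  ultimately have deg_r: "degree r = d" by (simp add: le_antisym le_degree)
  then have r0: "r \<noteq> 0" using d_pos by auto
  have root: "poly q t \<noteq> 0 \<and> pt t $ k = b \<and> t \<in> F \<and> t \<notin> B \<and> poly (pderiv r) t \<noteq> 0" if t: "poly r t = 0" for t
  proof -
    have e: "poly (p $ k) t = b * poly q t" using t by (simp add: r_def)
    then have qt: "poly q t \<noteq> 0" using not_both_zero[of t] by auto
    then have pk: "pt t $ k = b" using e by (simp add: pt_def)
    then have tB: "t \<notin> B" using b(3) by blast
    have "poly W t = poly q t * poly (pderiv r) t"
      using e by (simp add: W_def r_def pderiv_diff pderiv_smult algebra_simps)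
    then have "poly (pderiv r) t \<noteq> 0" using tB by (auto simp: B_def)
    then show ?thesis using qt pk tB root_mem[OF r0 r_over t] by blast
  qed
  have "rsquarefree r"
    unfolding rsquarefree_roots using root by blast
  then have card_r: "card {t. poly r t = 0} = d"
    using rsquarefree_iff_card_roots[OF r0] deg_r by simp
  define H where "H = {v \<in> aff_space F. (\<Sum>i\<in>UNIV. axis k 1 $ i * v $ i) = b}"
  have sum_axis: "(\<Sum>i\<in>UNIV. axis k 1 $ i * v $ i) = v $ k" for v :: "complex ^ 'n"
  proof -
    have "(\<Sum>i\<in>UNIV. axis k 1 $ i * v $ i) = (\<Sum>i\<in>UNIV. if i = k then v $ i else 0)"
      by (intro sum.cong) (auto simp: axis_def)
    then show ?thesis by simp
  qed
  have H: "is_hyperplane F H"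
    unfolding is_hyperplane_def
    by (rule bexI[of _ "axis k 1"], rule bexI[of _ b])
      (use b(1) in \<open>auto simp: H_def mem_aff_space axis_def vec_eq_iff\<close>)
  have sec: "curve \<inter> H = pt ` {t. poly r t = 0}"
  proof (intro Set.set_eqI iffI)
    fix v assume "v \<in> curve \<inter> H"
    then have v: "v \<in> curve" "v $ k = b" by (auto simp: H_def sum_axis)
    then obtain t where t: "t \<in> F" "poly q t \<noteq> 0" "v = pt t"
      using curve_cases b(2) by blast
    then have "poly r t = 0" using v(2) by (simp add: r_def pt_def field_simps)
    then show "v \<in> pt ` {t. poly r t = 0}" using t(3) by blast
  next
    fix v assume "v \<in> pt ` {t. poly r t = 0}"
    then obtain t where t: "v = pt t" "poly r t = 0" by blast
    then show "v \<in> curve \<inter> H"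
      using root[OF t(2)] pt_in_curve pt_in_aff by (simp add: H_def sum_axis)
  qed
  have "inj_on pt {t. poly r t = 0}"
    by (rule inj_on_subset[OF inj_on_pt]) (use root in \<open>auto simp: B_def\<close>)
  then have "card (curve \<inter> H) = d"
    unfolding sec by (simp add: card_image card_r)
  moreover have "finite (curve \<inter> H)"
    unfolding sec using r0 poly_roots_finite by blast
  ultimately show ?thesis using H that by blast
qed

lemma curve_degree_curve: "curve_degree F curve = d"
  unfolding curve_degree_def
proof (rule cSup_eq_maximum)
  show "d \<in> {card (curve \<inter> H) | H. is_hyperplane F H \<and> finite (curve \<inter> H)}"
  proof (rule hyperplane_section_attained)
    fix H assume "is_hyperplane F H" "finite (curve \<inter> H)" "card (curve \<inter> H) = d"
    then show ?thesis by (intro CollectI exI[of _ H]) auto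
  qed
  fix n assume "n \<in> {card (curve \<inter> H) | H. is_hyperplane F H \<and> finite (curve \<inter> H)}"
  then show "n \<le> d" using card_hyperplane_section_le by auto
qed

text \<open>
  The inverse map is \<open>num / den\<close>.  Its domain must not contain \<open>pt_inf\<close>, which is why the factor
  \<open>v $ k - pt_inf $ k\<close> is added to the equation of the complement.
\<close>
lemma rational_curve_curve: "rational_curve F curve"
proof -
  define E where "E = exc \<union> {t. poly (p $ k - smult (pt_inf $ k) q) t = 0}"
  have "p $ k - smult (pt_inf $ k) q \<noteq> 0"
  proof
    assume "p $ k - smult (pt_inf $ k) q = 0"
    then have "q dvd p $ k" by (metis dvd_refl dvd_smult eq_iff_diff_eq_0)
    then have "is_unit q" using cop by (metis coprime_common_divisor dvd_refl)
    then show False using d_pos deg_q by (simp add: is_unit_iff_degree[OF q_nz])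
  qed
  then have finE: "finite E"
    unfolding E_def using finite_exc poly_roots_finite by blast
  have E_pole: "poly q t \<noteq> 0" if "t \<notin> E" for t
    using that pole_in_exc by (auto simp: E_def)
  define z where "z v = den (hcoords v 1) * (v $ k - pt_inf $ k)" for v :: "complex ^ 'n"
  have inf_F: "pt_inf $ i \<in> F" for i
    using over_p over_q by (simp add: pt_inf_def)
  have pfun_z: "pfun UNIV z"
    unfolding z_def
    by (intro pfun_UNIV_mult pfun_dehomogenize[OF pfun_den] pfun_diff pfun_coord pfun_const)
      (auto simp: inf_F)
  have z_pt: "z (pt t) = 0 \<longleftrightarrow> t \<in> E" if "poly q t \<noteq> 0" for t
  proof -
    have "pt t $ k = pt_inf $ k \<longleftrightarrow> poly (p $ k - smult (pt_inf $ k) q) t = 0"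
      using that by (simp add: pt_def field_simps)
    moreover have "den (hcoords (pt t) 1) = 0 \<longleftrightarrow> t \<in> exc"
      using that by (simp add: exc_def hcoords_numerators[OF that] pfun_scale[OF pfun_den])
    ultimately show ?thesis by (auto simp: z_def E_def)
  qed
  define \<phi> :: "complex ^ 1 \<Rightarrow> complex ^ 'n" where "\<phi> u = pt (u $ 1)" for u
  define \<psi> :: "complex ^ 'n \<Rightarrow> complex ^ 1"
    where "\<psi> v = (\<chi> i. num (hcoords v 1) / den (hcoords v 1))" for v
  define U :: "(complex ^ 1) set" where "U = {u \<in> aff_space F. u $ 1 \<notin> E}"
  define V where "V = curve - {v \<in> aff_space F. z v = 0}"
  have U_F: "u $ 1 \<in> F" if "u \<in> U" for u using that by (simp add: U_def mem_aff_space)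
  have "birational_map F (aff_space F) curve \<phi>"
    unfolding birational_map_def
  proof (intro exI conjI)
    show "zopen_in F (aff_space F) U"
      unfolding zopen_in_def
    proof (intro exI conjI)
      have "pfun UNIV (\<lambda>u :: complex ^ 1. \<Prod>e\<in>E \<inter> F. u $ 1 - e)"
        by (intro pfun_prod pfun_diff pfun_coord pfun_const) auto
      then show "zclosed F {u \<in> aff_space F :: (complex ^ 1) set. (\<Prod>e\<in>E \<inter> F. u $ 1 - e) = 0}"
        by (rule zclosed_pfun_zeros)
      show "U = aff_space F - {u \<in> aff_space F. (\<Prod>e\<in>E \<inter> F. u $ 1 - e) = 0}"
        using finE by (auto simp: U_def mem_aff_space)
    qed
    obtain t where "t \<in> F" "t \<notin> E"
      using exists_F_minus[OF finE] by blast
    then have "(\<chi> i. t) \<in> U" by (simp add: U_def mem_aff_space)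
    then show Une: "U \<noteq> {}" by blast
    show "zopen_in F curve V"
      unfolding zopen_in_def V_def using zclosed_pfun_zeros[OF pfun_z] by blast
    show "regular_on F U \<phi>"
      by (rule regular_onI[of "\<lambda>i v. poly (p $ i) (v $ 1)" "\<lambda>i v. poly q (v $ 1)"])
        (use over_p over_q E_pole in \<open>auto intro: pfun_poly simp: U_def \<phi>_def pt_def\<close>)
    show "regular_on F V \<psi>"
    proof (rule regular_onI[of "\<lambda>i v. num (hcoords v 1)" "\<lambda>i v. den (hcoords v 1)"])
      show "den (hcoords v 1) \<noteq> 0" if "v \<in> V" for v
        using that curve_subset_aff by (auto simp: V_def z_def)
    qed (auto simp: \<psi>_def intro: pfun_dehomogenize[OF pfun_num] pfun_dehomogenize[OF pfun_den])
    show img: "\<phi> ` U = V"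
    proof (intro Set.set_eqI iffI)
      fix v assume "v \<in> \<phi> ` U"
      then obtain u where u: "u \<in> U" "v = pt (u $ 1)" by (auto simp: \<phi>_def)
      then have "u $ 1 \<notin> E" by (simp add: U_def)
      then show "v \<in> V"
        using u U_F pt_in_curve z_pt[OF E_pole] E_pole by (simp add: V_def)
    next
      fix v assume v: "v \<in> V"
      then have "z v \<noteq> 0" "v \<in> curve" using curve_subset_aff by (auto simp: V_def)
      then obtain t where t: "t \<in> F" "poly q t \<noteq> 0" "v = pt t"
        using curve_cases[of v] by (auto simp: z_def)
      then have "t \<notin> E" using z_pt \<open>z v \<noteq> 0\<close> by blast
      then have "(\<chi> i. t) \<in> U" using t by (simp add: U_def mem_aff_space)
      then show "v \<in> \<phi> ` U" using t(3) by (intro image_eqI[of _ _ "\<chi> i. t"]) (simp_all add: \<phi>_def)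
    qed
    then show "V \<noteq> {}" using Une by blast
    show "\<forall>u\<in>U. \<psi> (\<phi> u) = u"
    proof
      fix u assume "u \<in> U"
      then have "u $ 1 \<notin> exc" by (simp add: U_def E_def)
      then show "\<psi> (\<phi> u) = u"
        by (simp add: \<psi>_def \<phi>_def vec_eq_iff parameter_of_pt(2))
    qed
  qed
  then show ?thesis
    unfolding rational_curve_def using zirreducible_curve by blast
qed

end

section \<open>Points at infinity, projection and interpolation\<close>

lemma is_subfield_of_real:
  assumes "is_subfield K"
  shows "is_subfield (complex_of_real ` K)"
  using assms unfolding is_subfield_def
  by (auto simp flip: of_real_add of_real_mult of_real_minus of_real_inverse)

lemma pi_z_nth: "pi_z v $ i = v $ (if i = 1 then 1 else 2)"
  using exhaust_2[of i] by (auto simp: pi_z_def)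

context rel_alg_closed
begin

text \<open>
  The projection is continuous for the Zariski topology.
\<close>
lemma pi_z_zclosure:
  assumes "v \<in> zclosure F A"
  shows "pi_z v \<in> zclosure F (pi_z ` A)"
proof (rule zclosureI)
  show "pi_z v \<in> aff_space F"
    using subsetD[OF zclosure_subset_aff assms] by (auto simp: mem_aff_space pi_z_nth)
  fix f :: "2 mpoly" assume f: "mpoly_over F f" "\<And>b. b \<in> pi_z ` A \<Longrightarrow> meval f b = 0"
  have "pfun UNIV (\<lambda>v. meval f (pi_z v))"
    by (rule pfun_compose[OF pfun_meval[OF f(1)]]) (simp add: pi_z_nth pfun_coord)
  then show "meval f (pi_z v) = 0"
    by (rule zclosure_pfun[OF assms]) (use f(2) in auto)
qed

lemma proj_pt_in_pts_at_infinity_iff: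
  assumes "v \<in> aff_space F" "v \<noteq> 0"
  shows "proj_pt F v 0 \<in> pts_at_infinity F A \<longleftrightarrow>
    (\<forall>g. mpoly_over F g \<and> homogeneous g \<and> (\<forall>a\<in>zclosure F A. meval g (hcoords a 1) = 0)
      \<longrightarrow> meval g (hcoords v 0) = 0)"
proof
  assume "proj_pt F v 0 \<in> pts_at_infinity F A"
  then obtain v' where v': "proj_pt F v 0 = proj_pt F v' 0"
    "\<And>g. mpoly_over F g \<Longrightarrow> homogeneous g \<Longrightarrow> (\<forall>a\<in>zclosure F A. meval g (hcoords a 1) = 0)
      \<Longrightarrow> meval g (hcoords v' 0) = 0"
    unfolding mem_pts_at_infinity_iff by blast
  then obtain c where c: "v = c *s v'"
    unfolding proj_pt_eq_iff by blast
  have "meval g (hcoords v 0) = 0"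
    if g: "mpoly_over F g" "homogeneous g" "\<forall>a\<in>zclosure F A. meval g (hcoords a 1) = 0" for g
  proof -
    obtain m where m: "pfun {m} (meval g)"
      using g(1,2) by (auto simp: homogeneous_def pfun_def)
    have "hcoords v 0 = c *s hcoords v' 0"
      by (auto simp: c hcoords_def vec_eq_iff split: option.splits)
    then show ?thesis
      using pfun_scale[OF m] v'(2)[OF g] by simp
  qed
  then show "\<forall>g. mpoly_over F g \<and> homogeneous g \<and> (\<forall>a\<in>zclosure F A. meval g (hcoords a 1) = 0)
      \<longrightarrow> meval g (hcoords v 0) = 0" by blast
next
  assume "\<forall>g. mpoly_over F g \<and> homogeneous g \<and> (\<forall>a\<in>zclosure F A. meval g (hcoords a 1) = 0)
      \<longrightarrow> meval g (hcoords v 0) = 0"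
  then show "proj_pt F v 0 \<in> pts_at_infinity F A"
    unfolding mem_pts_at_infinity_iff using assms by (intro exI[of _ v]) simp
qed

text \<open>
  A form that vanishes on the projection of \<open>A\<close> is also a form in the coordinates of the space, and
  as such it vanishes on \<open>A\<close>.  If \<open>pi_z v\<close> were zero, the point would be the center of the projection.
\<close>
lemma pi_z_pts_at_infinity:
  assumes v: "v \<in> aff_space F" "pi_z v \<noteq> 0" and inf: "proj_pt F v 0 \<in> pts_at_infinity F A"
  shows "proj_pt F (pi_z v) 0 \<in> pts_at_infinity F (pi_z ` A)"
proof -
  have v0: "v \<noteq> 0" using v(2) by (auto simp: vec_eq_iff pi_z_nth)
  have pv: "pi_z v \<in> aff_space F" using v(1) by (auto simp: mem_aff_space pi_z_nth)
  have "meval g (hcoords (pi_z v) 0) = 0"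
    if g: "mpoly_over F g" "homogeneous g" "\<forall>b\<in>zclosure F (pi_z ` A). meval g (hcoords b 1) = 0" for g
  proof -
    define \<sigma> :: "2 option \<Rightarrow> 3 option" where "\<sigma> = map_option (\<lambda>i. if i = 1 then 1 else 2)"
    obtain m where m: "pfun {m} (meval g)"
      using g(1,2) by (auto simp: homogeneous_def pfun_def)
    obtain h where h: "mpoly_over F h" "\<forall>e\<in>Poly_Mapping.keys h. mon_degree e = m"
      "\<And>w. meval g (\<chi> j. w $ \<sigma> j) = meval h w"
      using pfun_rename[OF m, of \<sigma>] by (auto simp: pfun_def)
    have proj: "(\<chi> j. hcoords u w $ \<sigma> j) = hcoords (pi_z u) w" for u w
      by (auto simp: vec_eq_iff hcoords_def \<sigma>_def pi_z_nth split: option.splits)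
    have "meval h (hcoords a 1) = 0" if "a \<in> zclosure F A" for a
      using g(3) pi_z_zclosure[OF that] by (simp add: h(3)[symmetric] proj)
    then have "meval h (hcoords v 0) = 0"
      using inf h(1,2) unfolding proj_pt_in_pts_at_infinity_iff[OF v(1) v0] homogeneous_def by blast
    then show ?thesis by (simp add: h(3)[symmetric] proj)
  qed
  then show ?thesis
    unfolding proj_pt_in_pts_at_infinity_iff[OF pv v(2)] by blast
qed

text \<open>
  This excludes that the parametrization of \<open>D\<close> is constant.
\<close>
lemma curve_degree_singleton:
  fixes v :: "complex ^ 'n::finite"
  assumes "v \<in> aff_space F"
  shows "curve_degree F {v} = 1"
  unfolding curve_degree_def
proof (rule cSup_eq_maximum)
  define k :: 'n where "k = undefined"
  define H where "H = {u \<in> aff_space F. (\<Sum>i\<in>UNIV. axis k 1 $ i * u $ i) = (\<Sum>i\<in>UNIV. axis k 1 $ i * v $ i)}"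
  have ax: "axis k 1 \<in> aff_space F" "axis k (1 :: complex) \<noteq> 0"
    by (auto simp: mem_aff_space axis_def vec_eq_iff)
  have "is_hyperplane F H"
    unfolding is_hyperplane_def H_def using ax assms
    by (intro bexI[of _ "axis k 1"] bexI[of _ "\<Sum>i\<in>UNIV. axis k 1 $ i * v $ i"])
      (auto simp: mem_aff_space intro!: F_sum)
  moreover have "{v} \<inter> H = {v}" using assms by (auto simp: H_def)
  ultimately show "1 \<in> {card ({v} \<inter> H) | H. is_hyperplane F H \<and> finite ({v} \<inter> H)}"
    by (intro CollectI exI[of _ H]) simp
  fix n assume "n \<in> {card ({v} \<inter> H) | H. is_hyperplane F H \<and> finite ({v} \<inter> H)}"
  then obtain H where "n = card ({v} \<inter> H)" by blast
  moreover have "card ({v} \<inter> H) \<le> card {v}" by (rule card_mono) auto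
  ultimately show "n \<le> 1" by simp
qed

lemma interpolation_over:
  assumes S: "finite S" "S \<subseteq> F" "S \<noteq> {}" and y: "\<And>x. x \<in> S \<Longrightarrow> y x \<in> F"
  shows "\<exists>!r. poly_over F r \<and> degree r < card S \<and> (\<forall>x\<in>S. poly r x = y x)"
proof (rule ex_ex1I)
  \<comment> \<open>Lagrange's basis polynomials, up to constant factors.\<close>
  define b where "b x = (\<Prod>u\<in>S - {x}. [:- u, 1:])" for x
  define r where "r = (\<Sum>x\<in>S. smult (y x / poly (b x) x) (b x))"
  have b_over: "poly_over F (b x)" for x
    unfolding b_def using S(2) by (intro poly_over_prod) auto
  have b_nz: "poly (b x) x \<noteq> 0" for x
    unfolding b_def using S(1) by (auto simp: poly_prod)
  have b_0: "poly (b x) u = 0" if "u \<in> S" "u \<noteq> x" for x u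
    unfolding b_def using S(1) that by (auto simp: poly_prod)
  have "degree (b x) \<le> card S - 1" if "x \<in> S" for x
    unfolding b_def using S(1) that by (simp add: degree_prod_sum_eq card_Diff_singleton)
  then have "degree r \<le> card S - 1"
    unfolding r_def using S(1) by (intro degree_sum_le order_trans[OF degree_smult_le]) auto
  moreover have "card S > 0" using S by (simp add: card_gt_0_iff)
  ultimately have "degree r < card S" by linarith
  moreover have "poly_over F r"
    unfolding r_def using b_over y S(2) by (intro poly_over_sum poly_over_smult F_divide poly_in_F) auto
  moreover have "poly r u = y u" if "u \<in> S" for u
  proof -
    have "poly r u = (\<Sum>x\<in>S. if x = u then y x else 0)"
      unfolding r_def poly_sum using b_nz b_0 that by (intro sum.cong) auto
    then show ?thesis using S(1) that by simp
  qed
  ultimately show "\<exists>r. poly_over F r \<and> degree r < card S \<and> (\<forall>x\<in>S. poly r x = y x)" by blast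
  fix r r'
  assume r: "poly_over F r \<and> degree r < card S \<and> (\<forall>x\<in>S. poly r x = y x)"
    and r': "poly_over F r' \<and> degree r' < card S \<and> (\<forall>x\<in>S. poly r' x = y x)"
  show "r = r'"
  proof (rule ccontr)
    assume "r \<noteq> r'"
    then have ne: "r - r' \<noteq> 0" by simp
    have "S \<subseteq> {x. poly (r - r') x = 0}" using r r' by auto
    then have "card S \<le> card {x. poly (r - r') x = 0}"
      using poly_roots_finite[OF ne] by (intro card_mono) auto
    also have "\<dots> \<le> degree (r - r')" by (rule card_poly_roots_bound[OF ne])
    also have "\<dots> < card S" using r r' by (intro degree_diff_less) auto
    finally show False by simp
  qed
qed

end

text \<open>
  A divisor of a square-free polynomial is, up to a constant factor, determined by its roots.
\<close>
lemma dvd_linear_of_rsquarefree: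
  fixes g q :: "complex poly"
  assumes "rsquarefree q" "g dvd q" and root: "\<And>t. poly g t = 0 \<Longrightarrow> t = x"
  shows "g dvd [:- x, 1:]"
proof -
  have q0: "q \<noteq> 0" using assms(1) by (simp add: rsquarefree_def)
  then have g0: "g \<noteq> 0" using assms(2) by auto
  show ?thesis
  proof (cases "degree g = 0")
    case True
    then have "is_unit g" using g0 by (simp add: is_unit_iff_degree)
    then show ?thesis by (rule unit_imp_dvd)
  next
    case False
    have "rsquarefree g"
      unfolding rsquarefree_def
    proof (intro conjI allI)
      fix a
      have "order a g \<le> order a q" using q0 assms(2) by (rule dvd_imp_order_le)
      moreover have "order a q \<le> 1" using assms(1) unfolding rsquarefree_def by (metis le_numeral_extra(4) zero_le_one)
      ultimately show "order a g = 0 \<or> order a g = 1" by linarith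
    qed (use g0 in simp)
    then have "g = smult (lead_coeff g) (\<Prod>z|poly g z = 0. [:- z, 1:])"
      using complex_poly_decompose_rsquarefree by simp
    also have "{z. poly g z = 0} = {x}"
    proof -
      obtain t where "poly g t = 0"
        using fundamental_theorem_of_algebra[of g] False by (auto simp: constant_degree)
      then show ?thesis using root by blast
    qed
    finally have "g = smult (lead_coeff g) [:- x, 1:]" by simp
    then show ?thesis using g0 by (metis dvd_refl leading_coeff_0_iff smult_dvd)
  qed
qed

section \<open>The lifted curve\<close>

theorem theorem3p1:
  fixes K :: "real set" and KC F :: "complex set"
    and s :: nat and f :: "nat \<Rightarrow> 3 mpoly"
    and C Cbar :: "(complex ^ 3) set" and D :: "(complex ^ 2) set"
    and p1 p2 q :: "complex poly"
  assumes K: "computable_subfield K"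
    and KC: "KC = complex_of_real ` K"
    and F: "F = alg_closure KC"
    and s: "s \<ge> 2"
    and f: "\<forall>i\<in>{1..s}. mpoly_over KC (f i)"
    and C: "C = zeros F (f ` {1..s})"
    and C_curve: "irreducible_curve F C"
    and C_real: "real_curve C"
    and C_nonplanar: "\<not> planar F C"
    and i: "finite (pts_at_infinity F C)" "card (pts_at_infinity F C) = curve_degree F C"
    and ii: "birational_map F C (zclosure F (pi_z ` C)) pi_z"
            "curve_degree F C = curve_degree F (zclosure F (pi_z ` C))"
    and iii: "\<forall>l\<in>F. proj_pt F (vector [1, 0, l]) 0 \<notin> pts_at_infinity F C"
             "\<forall>m\<in>F. proj_pt F (vector [0, 1, m]) 0 \<notin> pts_at_infinity F C"
             "proj_pt F (vector [0, 0, 1]) 0 \<notin> pts_at_infinity F C"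
    and iv: "\<forall>l\<in>F. \<forall>m\<in>F. \<forall>m'\<in>F.
               proj_pt F (vector [1, l, m]) 0 \<in> pts_at_infinity F C \<longrightarrow>
               proj_pt F (vector [1, l, m']) 0 \<in> pts_at_infinity F C \<longrightarrow> m = m'"
    and v: "Poly_Mapping.lookup (f 1) (Poly_Mapping.single 3 (tdeg (f 1))) \<noteq> 0"
    and Q_over: "poly_over KC p1" "poly_over KC p2" "poly_over KC q"
    and q: "q \<noteq> 0"
    and D: "D = param_curve F (vector [p1, p2]) q"
    and D_deg: "curve_degree F D = curve_degree F (zclosure F (pi_z ` C))"
    and D_inf: "pts_at_infinity F D = pts_at_infinity F (pi_z ` C)"
    and Q_deg: "degree p1 \<le> degree q" "degree p2 \<le> degree q" "degree q = curve_degree F D"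
    and Q_gcd: "coprime p1 q" "coprime p2 q"
    and Q_inf: "\<forall>P\<in>pts_at_infinity F D. \<exists>t0\<in>F.
                  P = proj_pt F (vector [poly p1 t0, poly p2 t0]) (poly q t0)"
    and Cbar: "Cbar = lifted_curve F C p1 p2 q"
  shows "rational_curve F Cbar \<and>
         pts_at_infinity F C = pts_at_infinity F Cbar \<and>
         curve_degree F C = curve_degree F Cbar \<and>
         zclosure F (pi_z ` Cbar) = D"
proof -
  have "is_subfield KC"
    using K KC is_subfield_of_real by (auto simp: computable_subfield_def)
  then interpret rel_alg_closed F
    unfolding F by (rule rel_alg_closed_alg_closure)
  have "KC \<subseteq> F"
    using subset_alg_closure[OF \<open>is_subfield KC\<close>] F by simp
  then have over: "poly_over F p1" "poly_over F p2" "poly_over F q"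
    using Q_over unfolding poly_over_def by blast+
  define d where "d = degree q"
  have dC: "curve_degree F C = d" and dD: "curve_degree F D = d"
    using ii(2) D_deg Q_deg(3) by (simp_all add: d_def)
  \<comment> \<open>Otherwise \<open>D\<close> would be a point, of degree 1.\<close>
  have "d \<noteq> 0"
  proof
    assume "d = 0"
    then obtain a1 a2 b where ab: "p1 = [:a1:]" "p2 = [:a2:]" "q = [:b:]"
      using Q_deg by (metis d_def degree_eq_zeroE le_zero_eq)
    have "{(\<chi> i. poly (vector [p1, p2] $ i) t / poly q t) | t. t \<in> F \<and> poly q t \<noteq> 0} =
        {vector [a1 / b, a2 / b] :: complex ^ 2}"
      using q ab F_0 by (auto simp: vec_eq_iff forall_2 intro!: exI[of _ 0])
    moreover have aff: "vector [a1 / b, a2 / b] \<in> (aff_space F :: (complex ^ 2) set)"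
      using over ab by (auto simp: mem_aff_space forall_2)
    ultimately have "curve_degree F D = 1"
      unfolding D param_curve_def using zclosure_singleton[OF aff] curve_degree_singleton[OF aff] by simp
    then show False using dD \<open>d = 0\<close> by simp
  qed
  then have d: "d > 0" by simp

  define roots where "roots = {\<xi>. poly q \<xi> = 0}"
  define h where "h \<xi> = poly p2 \<xi> / poly p1 \<xi>" for \<xi>
  have roots_F: "roots \<subseteq> F"
    using root_mem[OF q over(3)] by (auto simp: roots_def)
  have fin_roots: "finite roots" and card_roots_le: "card roots \<le> d"
    using poly_roots_finite[OF q] card_poly_roots_bound[OF q] by (simp_all add: roots_def d_def)
  have p1_nz: "poly p1 \<xi> \<noteq> 0" if "\<xi> \<in> roots" for \<xi>
    using that Q_gcd(1) coprime_poly_0 by (auto simp: roots_def)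
  have aff3: "vector [a, b, c] \<in> (aff_space F :: (complex ^ 3) set)" if "a \<in> F" "b \<in> F" "c \<in> F" for a b c
    using that by (simp add: mem_aff_space forall_3)
  have C_inf_form: "\<exists>l\<in>F. \<exists>m\<in>F. c = proj_pt F (vector [1, l, m]) 0" if c: "c \<in> pts_at_infinity F C" for c
  proof -
    obtain v where v: "v \<in> aff_space F" "v \<noteq> 0" "c = proj_pt F v 0"
      using c unfolding mem_pts_at_infinity_iff by blast
    have vF: "v $ i \<in> F" for i using v(1) by (simp add: mem_aff_space)
    have "v $ 1 \<noteq> 0"
    proof
      assume v1: "v $ 1 = 0"
      show False
      proof (cases "v $ 2 = 0")
        case True
        then have "v $ 3 \<noteq> 0" using v(2) v1 by (auto simp: vec_eq_iff forall_3)
        then have "proj_pt F v 0 = proj_pt F (vector [0, 0, 1]) 0"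
          unfolding proj_pt_eq_iff using True v1 vF
          by (intro bexI[of _ "v $ 3"]) (auto simp: vec_eq_iff forall_3)
        then show False using iii(3) c v(3) by simp
      next
        case False
        then have "proj_pt F v 0 = proj_pt F (vector [0, 1, v $ 3 / v $ 2]) 0"
          unfolding proj_pt_eq_iff using v1 vF
          by (intro bexI[of _ "v $ 2"]) (auto simp: vec_eq_iff forall_3)
        then show False using iii(2) c v(3) vF by auto
      qed
    qed
    then have "proj_pt F v 0 = proj_pt F (vector [1, v $ 2 / v $ 1, v $ 3 / v $ 1]) 0"
      unfolding proj_pt_eq_iff using vF
      by (intro bexI[of _ "v $ 1"]) (auto simp: vec_eq_iff forall_3)
    then show ?thesis using v(3) vF by (meson F_divide)
  qed

  define L where "L = {l \<in> F. \<exists>m\<in>F. proj_pt F (vector [1, l, m]) 0 \<in> pts_at_infinity F C}"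
  \<comment> \<open>The points of \<open>C\<close> at infinity project to points of \<open>D\<close> at infinity, which come from roots of \<open>q\<close>.\<close>
  have L_roots: "L \<subseteq> h ` roots"
  proof
    fix l assume "l \<in> L"
    then obtain m where lm: "l \<in> F" "m \<in> F" "proj_pt F (vector [1, l, m]) 0 \<in> pts_at_infinity F C"
      by (auto simp: L_def)
    have pv: "pi_z (vector [1, l, m]) = vector [1, l]"
      by (simp add: pi_z_def)
    have "(vector [1, l] :: complex ^ 2) \<noteq> 0"
      by (simp add: vec_eq_iff forall_2)
    then have "proj_pt F (vector [1, l] :: complex ^ 2) 0 \<in> pts_at_infinity F D"
      using pi_z_pts_at_infinity[OF aff3[OF F_1 lm(1,2)] _ lm(3)] by (simp add: pv D_inf)
    then obtain t0 where "t0 \<in> F" "proj_pt F (vector [1, l] :: complex ^ 2) 0 =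
        proj_pt F (vector [poly p1 t0, poly p2 t0]) (poly q t0)"
      using Q_inf by blast
    then obtain e where e: "e \<noteq> 0" "(vector [1, l] :: complex ^ 2) = e *s vector [poly p1 t0, poly p2 t0]"
      "e * poly q t0 = 0"
      unfolding proj_pt_eq_iff by auto
    then have "1 = e * poly p1 t0" "l = e * poly p2 t0"
      by (auto simp: vec_eq_iff forall_2)
    then have le: "1 = e * poly p1 t0" "l = e * poly p2 t0" "poly p1 t0 \<noteq> 0"
      by auto
    have "l * poly p1 t0 = poly p2 t0 * (e * poly p1 t0)"
      by (simp add: le(2))
    then have "l = h t0" "t0 \<in> roots"
      using e le by (simp_all add: h_def roots_def eq_divide_eq)
    then show "l \<in> h ` roots" by blast
  qed
  have "card (pts_at_infinity F C) \<le> card L"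
  proof -
    define chi where "chi l = (SOME m. m \<in> F \<and> proj_pt F (vector [1, l, m]) 0 \<in> pts_at_infinity F C)" for l
    have "pts_at_infinity F C \<subseteq> (\<lambda>l. proj_pt F (vector [1, l, chi l]) 0) ` L"
    proof
      fix c assume c: "c \<in> pts_at_infinity F C"
      then obtain l m where lm: "l \<in> F" "m \<in> F" "c = proj_pt F (vector [1, l, m]) 0"
        using C_inf_form by blast
      have "chi l \<in> F \<and> proj_pt F (vector [1, l, chi l]) 0 \<in> pts_at_infinity F C"
        unfolding chi_def by (rule someI[of _ m]) (use lm c in simp)
      then have "chi l = m" using iv lm c by blast
      then show "c \<in> (\<lambda>l. proj_pt F (vector [1, l, chi l]) 0) ` L"
        using lm c by (intro image_eqI[of _ _ l]) (auto simp: L_def)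
    qed
    moreover have "finite L" using L_roots fin_roots finite_subset by blast
    ultimately show ?thesis by (rule surj_card_le[rotated])
  qed
  \<comment> \<open>Now \<open>d \<le> card L \<le> card (h ` roots) \<le> card roots \<le> d\<close>, so all of these are equal.\<close>
  moreover have "card L \<le> card (h ` roots)" "card (h ` roots) \<le> card roots"
    using L_roots fin_roots by (auto intro: card_mono card_image_le)
  ultimately have card_roots: "card roots = d" and "card L = card (h ` roots)" "card (h ` roots) = card roots"
    using card_roots_le i(2) dC by linarith+
  then have L_eq: "L = h ` roots" and h_inj: "inj_on h roots"
    using card_subset_eq[OF _ L_roots] fin_roots by (auto intro: eq_card_imp_inj_on)
  have sqfree: "rsquarefree q"
    using card_roots by (simp add: rsquarefree_iff_card_roots[OF q] roots_def d_def)

  define \<kappa> where "\<kappa> = lift_value F C p1 p2"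
  have \<kappa>: "\<kappa> \<xi> \<in> F" "proj_pt F (vector [1, h \<xi>, \<kappa> \<xi>]) 0 \<in> pts_at_infinity F C" if "\<xi> \<in> roots" for \<xi>
  proof -
    have "h \<xi> \<in> L" using that L_eq by blast
    then have "\<exists>!c. c \<in> F \<and> proj_pt F (vector [1, h \<xi>, c]) 0 \<in> pts_at_infinity F C"
      using iv by (auto simp: L_def)
    from theI'[OF this] show "\<kappa> \<xi> \<in> F" "proj_pt F (vector [1, h \<xi>, \<kappa> \<xi>]) 0 \<in> pts_at_infinity F C"
      by (auto simp: \<kappa>_def lift_value_def h_def)
  qed
  define p3 where "p3 = lift_poly F C p1 p2 q"
  have p3: "poly_over F p3" "degree p3 < d" "\<And>\<xi>. \<xi> \<in> roots \<Longrightarrow> poly p3 \<xi> = poly p1 \<xi> * \<kappa> \<xi>"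
  proof -
    have roots_ne: "roots \<noteq> {}" using card_roots d by auto
    have y: "poly p1 \<xi> * \<kappa> \<xi> \<in> F" if "\<xi> \<in> roots" for \<xi>
      using that \<kappa>(1) over(1) roots_F by (intro F_mult poly_in_F) auto
    have eq: "(\<forall>\<xi>\<in>F. poly q \<xi> = 0 \<longrightarrow> poly r \<xi> = poly p1 \<xi> * lift_value F C p1 p2 \<xi>) \<longleftrightarrow>
        (\<forall>\<xi>\<in>roots. poly r \<xi> = poly p1 \<xi> * \<kappa> \<xi>)" for r
      using roots_F by (auto simp: roots_def \<kappa>_def)
    have "p3 = (THE r. poly_over F r \<and> degree r < card roots \<and> (\<forall>\<xi>\<in>roots. poly r \<xi> = poly p1 \<xi> * \<kappa> \<xi>))"
      unfolding p3_def lift_poly_def dC card_roots eq ..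
    then have "poly_over F p3 \<and> degree p3 < card roots \<and> (\<forall>\<xi>\<in>roots. poly p3 \<xi> = poly p1 \<xi> * \<kappa> \<xi>)"
      using theI'[OF interpolation_over[OF fin_roots roots_F roots_ne y]] by simp
    then show "poly_over F p3" "degree p3 < d" "\<And>\<xi>. \<xi> \<in> roots \<Longrightarrow> poly p3 \<xi> = poly p1 \<xi> * \<kappa> \<xi>"
      using card_roots by auto
  qed

  interpret par: affine_param F "vector [p1, p2, p3] :: complex poly ^ 3" q d 1
  proof
    show "poly_over F ((vector [p1, p2, p3] :: complex poly ^ 3) $ i)"
      and "degree ((vector [p1, p2, p3] :: complex poly ^ 3) $ i) \<le> d" for i
      using exhaust_3[of i] over p3(1,2) Q_deg(1,2) by (auto simp: d_def)
    show "coprime ((vector [p1, p2, p3] :: complex poly ^ 3) $ 1) q"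
      using Q_gcd(1) by simp
  qed (use over d in \<open>simp_all add: d_def\<close>)
  have Cbar_eq: "Cbar = par.curve"
    unfolding Cbar lifted_curve_def p3_def[symmetric] par.curve_def ..

  \<comment> \<open>Any root of \<open>q\<close> will do: it is simple, and \<open>h\<close> separates it from the other roots.\<close>
  obtain \<xi>0 where \<xi>0: "\<xi>0 \<in> roots" using card_roots d by fastforce
  obtain num den where nd: "pfun {d} num" "pfun {d} den" "den (\<chi> i. poly (par.P $ i) \<xi>0) \<noteq> 0"
    "\<And>t. num (\<chi> i. poly (par.P $ i) t) = t * den (\<chi> i. poly (par.P $ i) t)"
  proof (rule inverse_of_param_unramified_at[of par.P d \<xi>0 "Some 1" None])
    fix g
    assume g: "\<And>j. g dvd smult (poly (par.P $ Some 1) \<xi>0) (par.P $ j) -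
        smult (poly (par.P $ j) \<xi>0) (par.P $ Some 1)"
    have q\<xi>0: "poly q \<xi>0 = 0" using \<xi>0 by (simp add: roots_def)
    have gq: "g dvd q"
      using g[of None] p1_nz[OF \<xi>0] q\<xi>0 by (simp add: dvd_smult_iff)
    show "g dvd [:- \<xi>0, 1:]"
    proof (rule dvd_linear_of_rsquarefree[OF sqfree gq])
      fix t assume t: "poly g t = 0"
      then have tr: "t \<in> roots" using gq by (auto simp: roots_def dvd_def)
      have "g dvd smult (poly p1 \<xi>0) p2 - smult (poly p2 \<xi>0) p1"
        using g[of "Some 2"] by simp
      then obtain u where u: "smult (poly p1 \<xi>0) p2 - smult (poly p2 \<xi>0) p1 = g * u" ..
      have "poly (smult (poly p1 \<xi>0) p2 - smult (poly p2 \<xi>0) p1) t = 0"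
        unfolding u using t by simp
      then have "h t = h \<xi>0"
        using p1_nz[OF tr] p1_nz[OF \<xi>0] by (simp add: h_def field_simps)
      then show "t = \<xi>0" using h_inj tr \<xi>0 by (auto dest: inj_onD)
    qed
  qed (use par.over_P par.deg_P \<xi>0 roots_F p1_nz d par.lc_q in \<open>auto simp: roots_def\<close>)

  interpret bir: birational_param F "vector [p1, p2, p3] :: complex poly ^ 3" q d 1 num den d
    by unfold_locales (use nd in \<open>auto simp: par.eval_P\<close>)

  have top: "proj_pt F (par.numerators \<xi>) 0 = proj_pt F (vector [1, h \<xi>, \<kappa> \<xi>]) 0" if "\<xi> \<in> roots" for \<xi>
    unfolding proj_pt_eq_iff using p1_nz[OF that] p3(3)[OF that] over(1) roots_F that
    by (intro bexI[of _ "poly p1 \<xi>"]) (auto simp: vec_eq_iff forall_3 par.numerators_def h_def)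
  have "pts_at_infinity F Cbar = {proj_pt F (vector [1, h \<xi>, \<kappa> \<xi>] :: complex ^ 3) 0 | \<xi>. \<xi> \<in> roots}"
    unfolding Cbar_eq par.pts_at_infinity_curve using top roots_F
    by (force simp: roots_def)
  also have "\<dots> = pts_at_infinity F C"
  proof (intro Set.set_eqI iffI)
    fix c assume "c \<in> {proj_pt F (vector [1, h \<xi>, \<kappa> \<xi>] :: complex ^ 3) 0 | \<xi>. \<xi> \<in> roots}"
    then show "c \<in> pts_at_infinity F C" using \<kappa>(2) by blast
  next
    fix c assume c: "c \<in> pts_at_infinity F C"
    then obtain l m where lm: "l \<in> F" "m \<in> F" "c = proj_pt F (vector [1, l, m]) 0"
      using C_inf_form by blast
    then have "l \<in> L" using c by (auto simp: L_def)
    then obtain \<xi> where \<xi>: "\<xi> \<in> roots" "l = h \<xi>" using L_eq by blast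
    then have "m = \<kappa> \<xi>" using iv \<kappa>[OF \<xi>(1)] lm c by blast
    then show "c \<in> {proj_pt F (vector [1, h \<xi>, \<kappa> \<xi>] :: complex ^ 3) 0 | \<xi>. \<xi> \<in> roots}"
      using lm(3) \<xi> by blast
  qed
  finally have infinity: "pts_at_infinity F C = pts_at_infinity F Cbar" ..

  have proj: "zclosure F (pi_z ` Cbar) = D"
  proof -
    define S2 where "S2 = {(\<chi> i. poly (vector [p1, p2] $ i) t / poly q t) :: complex ^ 2 | t. t \<in> F \<and> poly q t \<noteq> 0}"
    have D_S2: "D = zclosure F S2" by (simp add: D param_curve_def S2_def)
    have pt: "pi_z (par.pt t) = (\<chi> i. poly (vector [p1, p2] $ i) t / poly q t)" for t
      by (simp add: vec_eq_iff forall_2 pi_z_def par.pt_def)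
    have img: "pi_z ` {par.pt t | t. t \<in> F \<and> poly q t \<noteq> 0} = S2"
      by (auto simp: S2_def pt[symmetric])
    have "pi_z v \<in> D" if "v \<in> Cbar" for v
      using pi_z_zclosure[of v "{par.pt t | t. t \<in> F \<and> poly q t \<noteq> 0}"] that
      unfolding img D_S2 Cbar_eq par.curve_eq by blast
    then have "zclosure F (pi_z ` Cbar) \<subseteq> D"
      unfolding D_S2 by (intro zclosure_minimal zclosed_zclosure image_subsetI)
    moreover have "D \<subseteq> zclosure F (pi_z ` Cbar)"
      unfolding D_S2
    proof (rule zclosure_minimal[OF zclosed_zclosure])
      have "S2 \<subseteq> pi_z ` Cbar"
        unfolding img[symmetric] Cbar_eq using par.pt_in_curve by blast
      moreover have "pi_z ` Cbar \<subseteq> aff_space F"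
        using par.curve_subset_aff by (auto simp: Cbar_eq mem_aff_space pi_z_nth)
      ultimately show "S2 \<subseteq> zclosure F (pi_z ` Cbar)"
        using subset_zclosure by blast
    qed
    ultimately show ?thesis by blast
  qed
  show ?thesis
    using bir.rational_curve_curve infinity bir.curve_degree_curve dC proj
    by (simp add: Cbar_eq)
qed

end
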